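(* Let $\mathfrak g,\mathfrak n$ be topological Lie algebras over $\mathbb K$, $S:\mathfrak g\to\mathrm{der}\,\mathfrak n$ a continuous outer action and $\omega\in C^2(\mathfrak g,\mathfrak n)$ with $R_S=\mathrm{ad}\circ\omega$. Let $\mathfrak n_{\mathrm{ad}}:=\mathfrak n/\mathfrak z(\mathfrak n)\cong\mathrm{ad}\,\mathfrak n$ with the quotient topology, and let $\mathfrak g^S:=\mathfrak n_{\mathrm{ad}}\times\mathfrak g$ (topological product vector space) with the continuous alternating bilinear map $$[(\mathrm{ad}\,n,x),(\mathrm{ad}\,n',x')]:=\big(\mathrm{ad}([n,n']+S(x).n'-S(x').n+\omega(x,x')),[x,x']\big).$$ Then $\mathfrak g^S$ is a Lie algebra with the following properties: (1) The map $q_S:\mathfrak g^S\to\mathfrak g$, $(\mathrm{ad}\,n,x)\mapsto x$ is a topologically split extension of $\mathfrak g$ by $\mathfrak n_{\mathrm{ad}}$ which, up to equivalence of extensions, only depends on the class $[S]$. (2) The map $\rho:\mathfrak g^S\to\mathrm{der}\,\mathfrak n$, $(\mathrm{ad}\,n,x)\mapsto\mathrm{ad}\,n+S(x)$ defines a continuous $\mathfrak g^S$-module structure on $\mathfrak n$. (3) The map $\alpha:\mathfrak n\to\mathfrak g^S$, $n\mapsto(\mathrm{ad}\,n,0)$ is a topological crossed module which is topologically split if and only if $\mathfrak z(\mathfrak n)$ is topologically split in $\mathfrak n$. Moreover, $\ker\alpha=\mathfrak z(\mathfrak n)$ and $\mathrm{coker}(\alpha)=\mathfrak g^S/\mathfrak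 n_{\mathrm{ad}}\cong\mathfrak g$.
   Context: $\mathbb K$ is a topological field of characteristic $0$ (discrete topology allowed); topological vector spaces are Hausdorff. $C^p(\mathfrak g,V)$: continuous alternating $p$-linear maps; $\mathrm{der}\,\mathfrak n$: continuous derivations; $\mathfrak z(\mathfrak n)$: center. A continuous outer action is a linear map $S:\mathfrak g\to\mathrm{der}\,\mathfrak n$ with $\mathfrak g\times\mathfrak n\to\mathfrak n$, $(x,n)\mapsto S(x).n$ continuous and such that $R_S(x,y):=[S(x),S(y)]-S([x,y])$ equals $\mathrm{ad}(\omega(x,y))$ for some $\omega\in C^2(\mathfrak g,\mathfrak n)$. $S\sim S'$ if $S=S'+\mathrm{ad}\circ\gamma$ with a continuous linear $\gamma:\mathfrak g\to\mathfrak n$; $[S]$ is the class. (The bracket on $\mathfrak g^S$ does not depend on the choice of $\omega$.) A subspace $W\subseteq V$ is topologically split if it is closed and $V\to V/W$ has a continuous linear section $\sigma$ with $W\times V/W\to V$, $(w,x)\mapsto w+\sigma(x)$ a topological isomorphism; a morphism is topologically split if its kernel and image are topologically split. A topologically split extension of $\mathfrak g$ by $\mathfrak m$ is a topological Lie algebra $\hat{\mathfrak g}$ containing $\mathfrak m$ as a topologically split ideal together with a quotient morphism $\hat{\mathfrak g}\to\mathfrak g$ with kernel $\mathfrak m$; equivalence is an isomorphism of topological Lie algebras inducing the identity on $\mathfrak m$ and $\mathfrak g$. A topological crossed module is a morphism $\alpha:\mathfrak h\to\hat{\mathfrak g}$ of topological Lie algebras with a continuous $\hat{\mathfrak g}$-module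 structure on $\mathfrak h$ with $\alpha(x.h)=[x,\alpha(h)]$ and $\alpha(h).h'=[h,h']$. In (3) the module structure of $\mathfrak g^S$ on $\mathfrak n$ is the one from (2). *)

theory Defs
  imports
    "HOL-Analysis.T1_Spaces"
    "HOL-Analysis.Product_Topology"
    "HOL-Algebra.Module"
    "HOL-Algebra.AbelCoset"
begin

section \<open>Topological fields, vector spaces and Lie algebras\<close>

record 'a topological_ring = "'a ring" +
  ring_top :: "'a topology"

locale topological_field = field K for K (structure) +
  assumes topspace_ring_top: "topspace (ring_top K) = carrier K"
    and continuous_add:
      "continuous_map (prod_topology (ring_top K) (ring_top K)) (ring_top K) (\<lambda>(a, b). a \<oplus> b)"
    and continuous_uminus: "continuous_map (ring_top K) (ring_top K) (\<lambda>a. \<ominus> a)"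
    and continuous_mult:
      "continuous_map (prod_topology (ring_top K) (ring_top K)) (ring_top K) (\<lambda>(a, b). a \<otimes> b)"
    and continuous_inverse:
      "continuous_map (subtopology (ring_top K) (carrier K - {\<zero>})) (ring_top K) (\<lambda>a. inv a)"

definition char_0 :: "('a, 'm) ring_scheme \<Rightarrow> bool"
  where "char_0 R \<longleftrightarrow> (\<forall>k::nat. k > 0 \<longrightarrow> [k] \<cdot>\<^bsub>R\<^esub> \<one>\<^bsub>R\<^esub> \<noteq> \<zero>\<^bsub>R\<^esub>)"

text \<open>As for modules in HOL-Algebra, the inherited ring fields \<open>mult\<close> and \<open>one\<close> carry no meaning
  in the following two record types.\<close>

record ('a, 'b) lie = "('a, 'b) module" +
  lie_bracket :: "'b \<Rightarrow> 'b \<Rightarrow> 'b"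

record ('a, 'b) top_lie = "('a, 'b) lie" +
  lie_top :: "'b topology"

locale lie_algebra = module K L + field K for K (structure) and L (structure) +
  assumes bracket_closed:
      "\<lbrakk>x \<in> carrier L; y \<in> carrier L\<rbrakk> \<Longrightarrow> lie_bracket L x y \<in> carrier L"
    and bracket_add_left:
      "\<lbrakk>x \<in> carrier L; y \<in> carrier L; z \<in> carrier L\<rbrakk> \<Longrightarrow>
        lie_bracket L (x \<oplus>\<^bsub>L\<^esub> y) z = lie_bracket L x z \<oplus>\<^bsub>L\<^esub> lie_bracket L y z"
    and bracket_add_right:
      "\<lbrakk>x \<in> carrier L; y \<in> carrier L; z \<in> carrier L\<rbrakk> \<Longrightarrow>
        lie_bracket L x (y \<oplus>\<^bsub>L\<^esub> z) = lie_bracket L x y \<oplus>\<^bsub>L\<^esub> lie_bracket L x z"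
    and bracket_smult_left:
      "\<lbrakk>c \<in> carrier K; x \<in> carrier L; y \<in> carrier L\<rbrakk> \<Longrightarrow>
        lie_bracket L (c \<odot>\<^bsub>L\<^esub> x) y = c \<odot>\<^bsub>L\<^esub> lie_bracket L x y"
    and bracket_smult_right:
      "\<lbrakk>c \<in> carrier K; x \<in> carrier L; y \<in> carrier L\<rbrakk> \<Longrightarrow>
        lie_bracket L x (c \<odot>\<^bsub>L\<^esub> y) = c \<odot>\<^bsub>L\<^esub> lie_bracket L x y"
    and bracket_self: "x \<in> carrier L \<Longrightarrow> lie_bracket L x x = \<zero>\<^bsub>L\<^esub>"
    and jacobi:
      "\<lbrakk>x \<in> carrier L; y \<in> carrier L; z \<in> carrier L\<rbrakk> \<Longrightarrow>
        lie_bracket L x (lie_bracket L y z) \<oplus>\<^bsub>L\<^esub> lie_bracket L y (lie_bracket L z x)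
          \<oplus>\<^bsub>L\<^esub> lie_bracket L z (lie_bracket L x y) = \<zero>\<^bsub>L\<^esub>"

text \<open>A topological vector space is Hausdorff by definition. It is taken as a \<^typ>\<open>('a, 'b) top_lie\<close>
  whose bracket is ignored.\<close>

locale topological_vector_space =
  module K V + topological_field K for K (structure) and V (structure) +
  assumes topspace_lie_top: "topspace (lie_top V) = carrier V"
    and Hausdorff: "Hausdorff_space (lie_top V)"
    and continuous_vadd:
      "continuous_map (prod_topology (lie_top V) (lie_top V)) (lie_top V) (\<lambda>(x, y). x \<oplus>\<^bsub>V\<^esub> y)"
    and continuous_smult:
      "continuous_map (prod_topology (ring_top K) (lie_top V)) (lie_top V) (\<lambda>(c, x). c \<odot>\<^bsub>V\<^esub> x)"

locale topological_lie_algebra =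
  topological_vector_space K L + lie_algebra K L for K (structure) and L (structure) +
  assumes continuous_bracket:
    "continuous_map (prod_topology (lie_top L) (lie_top L)) (lie_top L)
       (\<lambda>(x, y). lie_bracket L x y)"


section \<open>Morphisms\<close>

definition linear_map ::
    "('k, 'c) ring_scheme \<Rightarrow> ('k, 'v, 'd) module_scheme \<Rightarrow> ('k, 'w, 'e) module_scheme
      \<Rightarrow> ('v \<Rightarrow> 'w) \<Rightarrow> bool"
  where "linear_map K V W f \<longleftrightarrow>
    f \<in> carrier V \<rightarrow> carrier W \<and>
    (\<forall>x\<in>carrier V. \<forall>y\<in>carrier V. f (x \<oplus>\<^bsub>V\<^esub> y) = f x \<oplus>\<^bsub>W\<^esub> f y) \<and>
    (\<forall>c\<in>carrier K. \<forall>x\<in>carrier V. f (c \<odot>\<^bsub>V\<^esub> x) = c \<odot>\<^bsub>W\<^esub> f x)"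

definition lie_hom ::
    "('k, 'c) ring_scheme \<Rightarrow> ('k, 'v, 'd) lie_scheme \<Rightarrow> ('k, 'w, 'e) lie_scheme
      \<Rightarrow> ('v \<Rightarrow> 'w) \<Rightarrow> bool"
  where "lie_hom K L M f \<longleftrightarrow>
    linear_map K L M f \<and>
    (\<forall>x\<in>carrier L. \<forall>y\<in>carrier L. f (lie_bracket L x y) = lie_bracket M (f x) (f y))"

definition continuous_linear_map ::
    "('k, 'c) ring_scheme \<Rightarrow> ('k, 'v) top_lie \<Rightarrow> ('k, 'w) top_lie \<Rightarrow> ('v \<Rightarrow> 'w) \<Rightarrow> bool"
  where "continuous_linear_map K V W f \<longleftrightarrow>
    linear_map K V W f \<and> continuous_map (lie_top V) (lie_top W) f"

definition tvs_iso ::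
    "('k, 'c) ring_scheme \<Rightarrow> ('k, 'v) top_lie \<Rightarrow> ('k, 'w) top_lie \<Rightarrow> ('v \<Rightarrow> 'w) \<Rightarrow> bool"
  where "tvs_iso K V W f \<longleftrightarrow>
    linear_map K V W f \<and> homeomorphic_map (lie_top V) (lie_top W) f"

definition top_lie_hom ::
    "('k, 'c) ring_scheme \<Rightarrow> ('k, 'v) top_lie \<Rightarrow> ('k, 'w) top_lie \<Rightarrow> ('v \<Rightarrow> 'w) \<Rightarrow> bool"
  where "top_lie_hom K L M f \<longleftrightarrow>
    lie_hom K L M f \<and> continuous_map (lie_top L) (lie_top M) f"

definition top_lie_iso ::
    "('k, 'c) ring_scheme \<Rightarrow> ('k, 'v) top_lie \<Rightarrow> ('k, 'w) top_lie \<Rightarrow> ('v \<Rightarrow> 'w) \<Rightarrow> bool"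
  where "top_lie_iso K L M f \<longleftrightarrow>
    lie_hom K L M f \<and> homeomorphic_map (lie_top L) (lie_top M) f"

definition quotient_morphism ::
    "('k, 'c) ring_scheme \<Rightarrow> ('k, 'v) top_lie \<Rightarrow> ('k, 'w) top_lie \<Rightarrow> ('v \<Rightarrow> 'w) \<Rightarrow> bool"
  where "quotient_morphism K L M f \<longleftrightarrow>
    lie_hom K L M f \<and> quotient_map (lie_top L) (lie_top M) f"


section \<open>Subspaces, quotients and products\<close>

text \<open>The brackets of \<open>sub V W\<close> and \<open>quot V W\<close> are meaningful only if \<open>W\<close> is a subalgebra,
  respectively an ideal; topological splitting uses these spaces without their brackets.\<close>

definition sub :: "('k, 'v) top_lie \<Rightarrow> 'v set \<Rightarrow> ('k, 'v) top_lie"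
  where "sub V W = V\<lparr>carrier := W, lie_top := subtopology (lie_top V) W\<rparr>"

definition quot_top :: "('k, 'v) top_lie \<Rightarrow> 'v set \<Rightarrow> 'v set topology"
  where "quot_top V W =
    topology (\<lambda>U. U \<subseteq> a_rcosets\<^bsub>V\<^esub> W \<and> openin (lie_top V) {v \<in> carrier V. W +>\<^bsub>V\<^esub> v \<in> U})"

definition quot :: "('k, 'v) top_lie \<Rightarrow> 'v set \<Rightarrow> ('k, 'v set) top_lie"
  where "quot V W =
    \<lparr>carrier = a_rcosets\<^bsub>V\<^esub> W,
     mult = undefined,
     one = undefined,
     zero = W,
     add = set_add V,
     smult = (\<lambda>c X. \<Union>v\<in>X. W +>\<^bsub>V\<^esub> (c \<odot>\<^bsub>V\<^esub> v)),
     lie_bracket = (\<lambda>X Y. \<Union>u\<in>X. \<Union>v\<in>Y. W +>\<^bsub>V\<^esub> lie_bracket V u v),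
     lie_top = quot_top V W\<rparr>"

definition direct_prod ::
    "('k, 'v) top_lie \<Rightarrow> ('k, 'w) top_lie \<Rightarrow> ('k, 'v \<times> 'w) top_lie"
  where "direct_prod V W =
    \<lparr>carrier = carrier V \<times> carrier W,
     mult = undefined,
     one = undefined,
     zero = (\<zero>\<^bsub>V\<^esub>, \<zero>\<^bsub>W\<^esub>),
     add = (\<lambda>(v, w) (v', w'). (v \<oplus>\<^bsub>V\<^esub> v', w \<oplus>\<^bsub>W\<^esub> w')),
     smult = (\<lambda>c (v, w). (c \<odot>\<^bsub>V\<^esub> v, c \<odot>\<^bsub>W\<^esub> w)),
     lie_bracket = (\<lambda>(v, w) (v', w'). (lie_bracket V v v', lie_bracket W w w')),
     lie_top = prod_topology (lie_top V) (lie_top W)\<rparr>"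

definition topologically_split ::
    "('k, 'c) ring_scheme \<Rightarrow> ('k, 'v) top_lie \<Rightarrow> 'v set \<Rightarrow> bool"
  where "topologically_split K V W \<longleftrightarrow>
    submodule W K V \<and> closedin (lie_top V) W \<and>
    (\<exists>\<sigma>. continuous_linear_map K (quot V W) V \<sigma> \<and>
         (\<forall>X\<in>carrier (quot V W). W +>\<^bsub>V\<^esub> \<sigma> X = X) \<and>
         tvs_iso K (direct_prod (sub V W) (quot V W)) V (\<lambda>(w, X). w \<oplus>\<^bsub>V\<^esub> \<sigma> X))"

definition topologically_split_morphism ::
    "('k, 'c) ring_scheme \<Rightarrow> ('k, 'v) top_lie \<Rightarrow> ('k, 'w) top_lie \<Rightarrow> ('v \<Rightarrow> 'w) \<Rightarrow> bool"
  where "topologically_split_morphism K L M f \<longleftrightarrow>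
    topologically_split K L (a_kernel L M f) \<and> topologically_split K M (f ` carrier L)"

definition coker :: "('k, 'v) top_lie \<Rightarrow> ('k, 'w) top_lie \<Rightarrow> ('v \<Rightarrow> 'w) \<Rightarrow> ('k, 'w set) top_lie"
  where "coker L M f = quot M (f ` carrier L)"

definition lie_ideal :: "('k, 'c) ring_scheme \<Rightarrow> ('k, 'v) top_lie \<Rightarrow> 'v set \<Rightarrow> bool"
  where "lie_ideal K L I \<longleftrightarrow>
    submodule I K L \<and> (\<forall>x\<in>carrier L. \<forall>y\<in>I. lie_bracket L x y \<in> I)"

definition center :: "('k, 'v) top_lie \<Rightarrow> 'v set"
  where "center L = {z \<in> carrier L. \<forall>x\<in>carrier L. lie_bracket L z x = \<zero>\<^bsub>L\<^esub>}"


section \<open>Extensions, modules and crossed modules\<close>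

text \<open>The inclusion of the ideal \<open>\<mm>\<close> into the extension is an explicit embedding \<open>\<iota>\<close>.\<close>

definition split_extension ::
    "('k, 'c) topological_ring_scheme \<Rightarrow> ('k, 'm) top_lie \<Rightarrow> ('k, 'e) top_lie \<Rightarrow> ('k, 'g) top_lie
      \<Rightarrow> ('m \<Rightarrow> 'e) \<Rightarrow> ('e \<Rightarrow> 'g) \<Rightarrow> bool"
  where "split_extension K \<mm> E \<gg> \<iota> q \<longleftrightarrow>
    topological_lie_algebra K \<mm> \<and> topological_lie_algebra K E \<and> topological_lie_algebra K \<gg> \<and>
    top_lie_iso K \<mm> (sub E (\<iota> ` carrier \<mm>)) \<iota> \<and>
    lie_ideal K E (\<iota> ` carrier \<mm>) \<and>
    topologically_split K E (\<iota> ` carrier \<mm>) \<and>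
    quotient_morphism K E \<gg> q \<and>
    a_kernel E \<gg> q = \<iota> ` carrier \<mm>"

definition equivalent_extensions ::
    "('k, 'c) ring_scheme \<Rightarrow> ('k, 'm) top_lie
      \<Rightarrow> ('k, 'e) top_lie \<Rightarrow> ('m \<Rightarrow> 'e) \<Rightarrow> ('e \<Rightarrow> 'g)
      \<Rightarrow> ('k, 'f) top_lie \<Rightarrow> ('m \<Rightarrow> 'f) \<Rightarrow> ('f \<Rightarrow> 'g) \<Rightarrow> bool"
  where "equivalent_extensions K \<mm> E \<iota> q E' \<iota>' q' \<longleftrightarrow>
    (\<exists>\<phi>. top_lie_iso K E E' \<phi> \<and>
         (\<forall>a\<in>carrier \<mm>. \<phi> (\<iota> a) = \<iota>' a) \<and>
         (\<forall>u\<in>carrier E. q' (\<phi> u) = q u))"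

definition continuous_module ::
    "('k, 'c) topological_ring_scheme \<Rightarrow> ('k, 'l) top_lie \<Rightarrow> ('k, 'v) top_lie
      \<Rightarrow> ('l \<Rightarrow> 'v \<Rightarrow> 'v) \<Rightarrow> bool"
  where "continuous_module K L V \<rho> \<longleftrightarrow>
    topological_lie_algebra K L \<and> topological_vector_space K V \<and>
    (\<forall>x\<in>carrier L. linear_map K V V (\<rho> x)) \<and>
    (\<forall>v\<in>carrier V. linear_map K L V (\<lambda>x. \<rho> x v)) \<and>
    (\<forall>x\<in>carrier L. \<forall>y\<in>carrier L. \<forall>v\<in>carrier V.
       \<rho> (lie_bracket L x y) v = \<rho> x (\<rho> y v) \<ominus>\<^bsub>V\<^esub> \<rho> y (\<rho> x v)) \<and>
    continuous_map (prod_topology (lie_top L) (lie_top V)) (lie_top V) (\<lambda>(x, v). \<rho> x v)"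

definition crossed_module ::
    "('k, 'c) topological_ring_scheme \<Rightarrow> ('k, 'h) top_lie \<Rightarrow> ('k, 'e) top_lie
      \<Rightarrow> ('h \<Rightarrow> 'e) \<Rightarrow> ('e \<Rightarrow> 'h \<Rightarrow> 'h) \<Rightarrow> bool"
  where "crossed_module K \<hh> E \<alpha> \<rho> \<longleftrightarrow>
    topological_lie_algebra K \<hh> \<and> topological_lie_algebra K E \<and>
    top_lie_hom K \<hh> E \<alpha> \<and>
    continuous_module K E \<hh> \<rho> \<and>
    (\<forall>x\<in>carrier E. \<forall>h\<in>carrier \<hh>. \<alpha> (\<rho> x h) = lie_bracket E x (\<alpha> h)) \<and>
    (\<forall>h\<in>carrier \<hh>. \<forall>h'\<in>carrier \<hh>. \<rho> (\<alpha> h) h' = lie_bracket \<hh> h h')"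


section \<open>Derivations and continuous outer actions\<close>

text \<open>Maps of \<open>\<nn>\<close> into itself are extensional functions on the carrier, so that equality in
  \<open>der K \<nn>\<close> is equality of maps on \<open>\<nn>\<close>.\<close>

definition der :: "('k, 'c) ring_scheme \<Rightarrow> ('k, 'n) top_lie \<Rightarrow> ('k, 'n \<Rightarrow> 'n) lie"
  where "der K \<nn> =
    \<lparr>carrier = {D \<in> extensional (carrier \<nn>).
        continuous_linear_map K \<nn> \<nn> D \<and>
        (\<forall>u\<in>carrier \<nn>. \<forall>v\<in>carrier \<nn>.
           D (lie_bracket \<nn> u v) = lie_bracket \<nn> (D u) v \<oplus>\<^bsub>\<nn>\<^esub> lie_bracket \<nn> u (D v))},
     mult = undefined,
     one = undefined,
     zero = (\<lambda>u\<in>carrier \<nn>. \<zero>\<^bsub>\<nn>\<^esub>),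
     add = (\<lambda>D E. \<lambda>u\<in>carrier \<nn>. D u \<oplus>\<^bsub>\<nn>\<^esub> E u),
     smult = (\<lambda>c D. \<lambda>u\<in>carrier \<nn>. c \<odot>\<^bsub>\<nn>\<^esub> D u),
     lie_bracket = (\<lambda>D E. \<lambda>u\<in>carrier \<nn>. D (E u) \<ominus>\<^bsub>\<nn>\<^esub> E (D u))\<rparr>"

definition ad :: "('k, 'n) top_lie \<Rightarrow> 'n \<Rightarrow> 'n \<Rightarrow> 'n"
  where "ad \<nn> u = (\<lambda>v\<in>carrier \<nn>. lie_bracket \<nn> u v)"

definition C2 ::
    "('k, 'c) ring_scheme \<Rightarrow> ('k, 'g) top_lie \<Rightarrow> ('k, 'v) top_lie \<Rightarrow> ('g \<Rightarrow> 'g \<Rightarrow> 'v) set"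
  where "C2 K \<gg> V = {\<omega>.
    (\<forall>x\<in>carrier \<gg>. linear_map K \<gg> V (\<omega> x)) \<and>
    (\<forall>y\<in>carrier \<gg>. linear_map K \<gg> V (\<lambda>x. \<omega> x y)) \<and>
    (\<forall>x\<in>carrier \<gg>. \<omega> x x = \<zero>\<^bsub>V\<^esub>) \<and>
    continuous_map (prod_topology (lie_top \<gg>) (lie_top \<gg>)) (lie_top V) (\<lambda>(x, y). \<omega> x y)}"

definition R_S ::
    "('k, 'c) ring_scheme \<Rightarrow> ('k, 'g) top_lie \<Rightarrow> ('k, 'n) top_lie \<Rightarrow> ('g \<Rightarrow> 'n \<Rightarrow> 'n)
      \<Rightarrow> 'g \<Rightarrow> 'g \<Rightarrow> 'n \<Rightarrow> 'n"
  where "R_S K \<gg> \<nn> S x y =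
    lie_bracket (der K \<nn>) (S x) (S y) \<ominus>\<^bsub>der K \<nn>\<^esub> S (lie_bracket \<gg> x y)"

definition curvature_is_ad ::
    "('k, 'c) ring_scheme \<Rightarrow> ('k, 'g) top_lie \<Rightarrow> ('k, 'n) top_lie \<Rightarrow> ('g \<Rightarrow> 'n \<Rightarrow> 'n)
      \<Rightarrow> ('g \<Rightarrow> 'g \<Rightarrow> 'n) \<Rightarrow> bool"
  where "curvature_is_ad K \<gg> \<nn> S \<omega> \<longleftrightarrow>
    (\<forall>x\<in>carrier \<gg>. \<forall>y\<in>carrier \<gg>. R_S K \<gg> \<nn> S x y = ad \<nn> (\<omega> x y))"

definition continuous_outer_action ::
    "('k, 'c) ring_scheme \<Rightarrow> ('k, 'g) top_lie \<Rightarrow> ('k, 'n) top_lie \<Rightarrow> ('g \<Rightarrow> 'n \<Rightarrow> 'n) \<Rightarrow> bool"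
  where "continuous_outer_action K \<gg> \<nn> S \<longleftrightarrow>
    linear_map K \<gg> (der K \<nn>) S \<and>
    continuous_map (prod_topology (lie_top \<gg>) (lie_top \<nn>)) (lie_top \<nn>) (\<lambda>(x, u). S x u) \<and>
    (\<exists>\<omega>\<in>C2 K \<gg> \<nn>. curvature_is_ad K \<gg> \<nn> S \<omega>)"

definition outer_equiv ::
    "('k, 'c) ring_scheme \<Rightarrow> ('k, 'g) top_lie \<Rightarrow> ('k, 'n) top_lie
      \<Rightarrow> ('g \<Rightarrow> 'n \<Rightarrow> 'n) \<Rightarrow> ('g \<Rightarrow> 'n \<Rightarrow> 'n) \<Rightarrow> bool"
  where "outer_equiv K \<gg> \<nn> S S' \<longleftrightarrow>
    (\<exists>\<gamma>. continuous_linear_map K \<gg> \<nn> \<gamma> \<and>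
         (\<forall>x\<in>carrier \<gg>. S x = S' x \<oplus>\<^bsub>der K \<nn>\<^esub> ad \<nn> (\<gamma> x)))"


section \<open>The Lie algebra of a continuous outer action\<close>

abbreviation n_ad :: "('k, 'n) top_lie \<Rightarrow> ('k, 'n set) top_lie"
  where "n_ad \<nn> \<equiv> quot \<nn> (center \<nn>)"

text \<open>The class of \<open>u\<close> in \<open>n_ad \<nn>\<close>, written \<open>ad u\<close> under the identification of the quotient by the
  center with the inner derivations.\<close>

abbreviation ad_class :: "('k, 'n) top_lie \<Rightarrow> 'n \<Rightarrow> 'n set"
  where "ad_class \<nn> u \<equiv> center \<nn> +>\<^bsub>\<nn>\<^esub> u"

definition gS ::
    "('k, 'g) top_lie \<Rightarrow> ('k, 'n) top_lie \<Rightarrow> ('g \<Rightarrow> 'n \<Rightarrow> 'n) \<Rightarrow> ('g \<Rightarrow> 'g \<Rightarrow> 'n)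
      \<Rightarrow> ('k, 'n set \<times> 'g) top_lie"
  where "gS \<gg> \<nn> S \<omega> = (direct_prod (n_ad \<nn>) \<gg>)
    \<lparr>lie_bracket := (\<lambda>(A, x) (A', x').
       (\<Union>u\<in>A. \<Union>u'\<in>A'.
          ad_class \<nn> (lie_bracket \<nn> u u' \<oplus>\<^bsub>\<nn>\<^esub> S x u' \<ominus>\<^bsub>\<nn>\<^esub> S x' u \<oplus>\<^bsub>\<nn>\<^esub> \<omega> x x'),
        lie_bracket \<gg> x x'))\<rparr>"

definition q_S :: "'n set \<times> 'g \<Rightarrow> 'g"
  where "q_S = (\<lambda>(A, x). x)"

definition n_ad_incl :: "('k, 'g) top_lie \<Rightarrow> 'n set \<Rightarrow> 'n set \<times> 'g"
  where "n_ad_incl \<gg> A = (A, \<zero>\<^bsub>\<gg>\<^esub>)"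

text \<open>All representatives of a coset \<open>A\<close> of the center have the same \<open>ad\<close>, which is therefore the
  unique element of the image of \<open>A\<close>.\<close>

definition rho_S ::
    "('k, 'c) ring_scheme \<Rightarrow> ('k, 'n) top_lie \<Rightarrow> ('g \<Rightarrow> 'n \<Rightarrow> 'n) \<Rightarrow> 'n set \<times> 'g \<Rightarrow> 'n \<Rightarrow> 'n"
  where "rho_S K \<nn> S = (\<lambda>(A, x). the_elem (ad \<nn> ` A) \<oplus>\<^bsub>der K \<nn>\<^esub> S x)"

definition alpha_S :: "('k, 'g) top_lie \<Rightarrow> ('k, 'n) top_lie \<Rightarrow> 'n \<Rightarrow> 'n set \<times> 'g"
  where "alpha_S \<gg> \<nn> u = (ad_class \<nn> u, \<zero>\<^bsub>\<gg>\<^esub>)"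

end

theory Submission
  imports Defs
begin

text \<open>The map \<open>(ad u, x) \<mapsto> (ad u + S x, x)\<close> from \<open>gS\<close> into the product of \<open>der \<nn>\<close> and \<open>\<gg>\<close> is
  linear and injective, and the condition \<open>R\<^sub>S = ad \<circ> \<omega>\<close> says exactly that it respects the brackets.
  So \<open>gS\<close> is a Lie algebra without any cocycle computation, its first component is the module
  structure \<open>\<rho>\<close>, and both the independence of \<open>\<omega>\<close> and the equivalence of the extensions for
  \<open>S\<close> and \<open>S' = S - ad \<circ> \<gamma>\<close> can be checked after applying it. Continuity is checked on
  representatives, because \<open>\<nn> \<rightarrow> \<nn>/\<zz>(\<nn>)\<close> is an open map. Since \<open>x \<mapsto> (0, x)\<close> is a continuous section
  of \<open>q\<^sub>S\<close>, the image of \<open>\<alpha>\<close> always splits, and only the kernel \<open>\<zz>(\<nn>)\<close> matters.\<close>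

section \<open>Algebra\<close>

text \<open>The obstacle is that S need not be a representation and \<omega> need not be a cocycle:
  its covariant differential vanishes only modulo the center. The bracket of \<open>gS\<close> is
  moreover a union over representatives, so well-definedness and the Jacobi identity would both be
  calculations modulo \<open>center \<nn>\<close>. The kernel of \<open>ad\<close> is exactly that
  center, so passing to \<open>der K \<nn>\<close> turns equality of classes into equality of honest
  maps, and the axioms of \<open>der K \<nn>\<close> can be proved pointwise. Since
  \<open>der K \<nn>\<close> carries no topology, this settles algebra only. The topological side
  has its own inputs: the center is closed because points are closed, which makes
  \<open>n_ad \<nn>\<close> Hausdorff; and the operations are functions of two variables on
  quotients, which calls for a class of quotient maps closed under products.\<close>

lemma (in abelian_group) a_inv_zero: "\<ominus> \<zero> = \<zero>"
  by (rule minus_equality) simp_all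

text \<open>Registers these identities with the \<open>algebra\<close> method for additive groups,
  so that rearrangements in modules, quotients and \<open>der K \<nn>\<close>, whose ring product is
  meaningless, are settled by normalisation.\<close>

lemmas (in abelian_group) abelian_group_simprules
  [algebra abelian_group "zero G" "add G" "a_inv G" "a_minus G"] =
  a_closed zero_closed a_inv_closed minus_closed a_assoc a_comm a_lcomm
  l_zero r_zero l_neg r_neg r_neg1 r_neg2 minus_eq minus_add minus_minus a_inv_zero

lemma (in abelian_group) minus_eq_zero_iff:
  "\<lbrakk>x \<in> carrier G; y \<in> carrier G\<rbrakk> \<Longrightarrow> x \<ominus> y = \<zero> \<longleftrightarrow> x = y"
  by (metis add.inv_solve_right l_zero minus_eq zero_closed)

section \<open>Linear maps, and the transport of module and Lie algebra axioms along them\<close>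

lemma linear_mapD:
  assumes "linear_map K V W f"
  shows "x \<in> carrier V \<Longrightarrow> f x \<in> carrier W"
    and "\<lbrakk>x \<in> carrier V; y \<in> carrier V\<rbrakk> \<Longrightarrow> f (x \<oplus>\<^bsub>V\<^esub> y) = f x \<oplus>\<^bsub>W\<^esub> f y"
    and "\<lbrakk>c \<in> carrier K; x \<in> carrier V\<rbrakk> \<Longrightarrow> f (c \<odot>\<^bsub>V\<^esub> x) = c \<odot>\<^bsub>W\<^esub> f x"
  using assms unfolding linear_map_def by auto

lemma linear_mapI:
  assumes "\<And>x. x \<in> carrier V \<Longrightarrow> f x \<in> carrier W"
    and "\<And>x y. \<lbrakk>x \<in> carrier V; y \<in> carrier V\<rbrakk> \<Longrightarrow> f (x \<oplus>\<^bsub>V\<^esub> y) = f x \<oplus>\<^bsub>W\<^esub> f y"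
    and "\<And>c x. \<lbrakk>c \<in> carrier K; x \<in> carrier V\<rbrakk> \<Longrightarrow> f (c \<odot>\<^bsub>V\<^esub> x) = c \<odot>\<^bsub>W\<^esub> f x"
  shows "linear_map K V W f"
  using assms unfolding linear_map_def by auto

lemma linear_map_zero:
  assumes "abelian_group V" "abelian_group W" "linear_map K V W f"
  shows "f \<zero>\<^bsub>V\<^esub> = \<zero>\<^bsub>W\<^esub>"
proof -
  interpret V: abelian_group V by fact
  interpret W: abelian_group W by fact
  have "f \<zero>\<^bsub>V\<^esub> \<oplus>\<^bsub>W\<^esub> f \<zero>\<^bsub>V\<^esub> = f \<zero>\<^bsub>V\<^esub>"
    using linear_mapD(2)[OF assms(3), of "\<zero>\<^bsub>V\<^esub>" "\<zero>\<^bsub>V\<^esub>"] by simp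
  then show ?thesis
    using linear_mapD(1)[OF assms(3) V.zero_closed] W.add.l_cancel_one by simp
qed

lemma linear_map_uminus:
  assumes "abelian_group V" "abelian_group W" "linear_map K V W f" "x \<in> carrier V"
  shows "f (\<ominus>\<^bsub>V\<^esub> x) = \<ominus>\<^bsub>W\<^esub> f x"
proof -
  interpret V: abelian_group V by fact
  interpret W: abelian_group W by fact
  note f = linear_mapD[OF assms(3)]
  have "f (\<ominus>\<^bsub>V\<^esub> x) \<oplus>\<^bsub>W\<^esub> f x = \<zero>\<^bsub>W\<^esub>"
    using f(2)[of "\<ominus>\<^bsub>V\<^esub> x" x] assms(4) linear_map_zero[OF assms(1-3)] by (simp add: V.l_neg)
  then show ?thesis
    using f(1) assms(4) by (metis V.a_inv_closed W.minus_equality)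
qed

lemma linear_map_minus:
  assumes "abelian_group V" "abelian_group W" "linear_map K V W f" "x \<in> carrier V" "y \<in> carrier V"
  shows "f (x \<ominus>\<^bsub>V\<^esub> y) = f x \<ominus>\<^bsub>W\<^esub> f y"
proof -
  interpret V: abelian_group V by fact
  show ?thesis
    using assms by (simp add: a_minus_def linear_mapD(2)[OF assms(3)] linear_map_uminus)
qed

lemma linear_map_compose:
  assumes "linear_map K U V f" "linear_map K V W g"
  shows "linear_map K U W (\<lambda>x. g (f x))"
  using assms unfolding linear_map_def Pi_def by simp

text \<open>Each axiom holds for preimages and is pushed forward. Nothing is known about the
  operations of \<open>W\<close> beforehand, so that \<open>f\<close> preserves zero cannot be
  derived and is a premise. This serves quotients, and also, with the identity map, a record in
  which only the bracket is replaced.\<close>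

lemma module_image:
  fixes V :: "('k, 'v, 'd) module_scheme" and W :: "('k, 'w, 'e) module_scheme"
  assumes V: "module K V" and f: "linear_map K V W f"
    and surj: "f ` carrier V = carrier W" and zero: "f \<zero>\<^bsub>V\<^esub> = \<zero>\<^bsub>W\<^esub>"
  shows "module K W"
proof -
  interpret V: module K V by fact
  note fD = linear_mapD[OF f]
  have lift: "\<exists>v\<in>carrier V. w = f v" if "w \<in> carrier W" for w
    using that surj by auto
  show ?thesis
  proof (rule moduleI)
    show "cring K" by (rule V.is_cring)
    show "abelian_group W"
    proof (rule abelian_groupI)
      show "\<zero>\<^bsub>W\<^esub> \<in> carrier W"
        using fD(1)[of "\<zero>\<^bsub>V\<^esub>"] zero by simp
      fix x assume x: "x \<in> carrier W"
      then obtain u where u: "u \<in> carrier V" "x = f u" using lift by blast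
      show "\<zero>\<^bsub>W\<^esub> \<oplus>\<^bsub>W\<^esub> x = x"
        using fD(2)[of "\<zero>\<^bsub>V\<^esub>" u] u zero by simp
      show "\<exists>y\<in>carrier W. y \<oplus>\<^bsub>W\<^esub> x = \<zero>\<^bsub>W\<^esub>"
        using fD(1)[of "\<ominus>\<^bsub>V\<^esub> u"] fD(2)[of "\<ominus>\<^bsub>V\<^esub> u" u] u zero by (force simp: V.M.l_neg)
      fix y assume y: "y \<in> carrier W"
      then obtain v where v: "v \<in> carrier V" "y = f v" using lift by blast
      show "x \<oplus>\<^bsub>W\<^esub> y \<in> carrier W"
        using fD(1)[of "u \<oplus>\<^bsub>V\<^esub> v"] fD(2)[of u v] u v by simp
      show "x \<oplus>\<^bsub>W\<^esub> y = y \<oplus>\<^bsub>W\<^esub> x"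
        using fD(2)[of u v] fD(2)[of v u] u v V.M.a_comm[of u v] by simp
      fix z assume z: "z \<in> carrier W"
      then obtain w where w: "w \<in> carrier V" "z = f w" using lift by blast
      show "x \<oplus>\<^bsub>W\<^esub> y \<oplus>\<^bsub>W\<^esub> z = x \<oplus>\<^bsub>W\<^esub> (y \<oplus>\<^bsub>W\<^esub> z)"
        using u v w by (simp add: fD(2)[symmetric] V.M.a_assoc)
    qed
    fix x assume "x \<in> carrier W"
    then obtain u where u: "u \<in> carrier V" "x = f u" using lift by blast
    show "\<one>\<^bsub>K\<^esub> \<odot>\<^bsub>W\<^esub> x = x"
      using u by (simp add: fD(3)[symmetric])
    fix a assume a: "a \<in> carrier K"
    show "a \<odot>\<^bsub>W\<^esub> x \<in> carrier W"
      using a u fD(1)[of "a \<odot>\<^bsub>V\<^esub> u"] fD(3)[of a u] by simp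
    {
      fix y assume "y \<in> carrier W"
      then obtain v where v: "v \<in> carrier V" "y = f v" using lift by blast
      show "a \<odot>\<^bsub>W\<^esub> (x \<oplus>\<^bsub>W\<^esub> y) = a \<odot>\<^bsub>W\<^esub> x \<oplus>\<^bsub>W\<^esub> a \<odot>\<^bsub>W\<^esub> y"
        using a u v by (simp add: fD(2,3)[symmetric] V.smult_r_distr)
    }
    fix b assume b: "b \<in> carrier K"
    show "(a \<oplus>\<^bsub>K\<^esub> b) \<odot>\<^bsub>W\<^esub> x = a \<odot>\<^bsub>W\<^esub> x \<oplus>\<^bsub>W\<^esub> b \<odot>\<^bsub>W\<^esub> x"
      using a b u by (simp add: fD(2,3)[symmetric] V.smult_l_distr)
    show "a \<otimes>\<^bsub>K\<^esub> b \<odot>\<^bsub>W\<^esub> x = a \<odot>\<^bsub>W\<^esub> (b \<odot>\<^bsub>W\<^esub> x)"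
      using a b u by (simp add: fD(2,3)[symmetric] V.smult_assoc1)
  qed
qed

lemma lie_algebra_image:
  assumes L: "lie_algebra K L" and f: "lie_hom K L M f"
    and surj: "f ` carrier L = carrier M" and zero: "f \<zero>\<^bsub>L\<^esub> = \<zero>\<^bsub>M\<^esub>"
  shows "lie_algebra K M"
proof -
  interpret L: lie_algebra K L by fact
  have lin: "linear_map K L M f"
    and fB: "\<And>x y. \<lbrakk>x \<in> carrier L; y \<in> carrier L\<rbrakk> \<Longrightarrow>
        f (lie_bracket L x y) = lie_bracket M (f x) (f y)"
    using f unfolding lie_hom_def by auto
  note fD = linear_mapD[OF lin]
  have lift: "\<exists>v\<in>carrier L. w = f v" if "w \<in> carrier M" for w
    using that surj by auto
  show ?thesis
  proof (intro lie_algebra.intro lie_algebra_axioms.intro)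
    show "module K M"
      using L.module_axioms lin surj zero by (rule module_image)
    show "field K" by (rule L.field_axioms)
    fix x assume "x \<in> carrier M"
    then obtain u where u: "u \<in> carrier L" "x = f u" using lift by blast
    show "lie_bracket M x x = \<zero>\<^bsub>M\<^esub>"
      using u by (simp add: fB[symmetric] L.bracket_self zero)
    fix y assume "y \<in> carrier M"
    then obtain v where v: "v \<in> carrier L" "y = f v" using lift by blast
    show "lie_bracket M x y \<in> carrier M"
      using u v fD(1)[of "lie_bracket L u v"] by (simp add: fB[symmetric] L.bracket_closed)
    {
      fix c assume c: "c \<in> carrier K"
      show "lie_bracket M (c \<odot>\<^bsub>M\<^esub> x) y = c \<odot>\<^bsub>M\<^esub> lie_bracket M x y"
        using u v c
        by (simp add: fB[symmetric] fD(3)[symmetric] L.bracket_smult_left L.bracket_closed)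
      show "lie_bracket M x (c \<odot>\<^bsub>M\<^esub> y) = c \<odot>\<^bsub>M\<^esub> lie_bracket M x y"
        using u v c
        by (simp add: fB[symmetric] fD(3)[symmetric] L.bracket_smult_right L.bracket_closed)
    }
    fix z assume "z \<in> carrier M"
    then obtain w where w: "w \<in> carrier L" "z = f w" using lift by blast
    note bracket = fB[symmetric] fD(2)[symmetric] L.bracket_closed
    show "lie_bracket M (x \<oplus>\<^bsub>M\<^esub> y) z = lie_bracket M x z \<oplus>\<^bsub>M\<^esub> lie_bracket M y z"
      using u v w by (simp add: bracket L.bracket_add_left)
    show "lie_bracket M x (y \<oplus>\<^bsub>M\<^esub> z) = lie_bracket M x y \<oplus>\<^bsub>M\<^esub> lie_bracket M x z"
      using u v w by (simp add: bracket L.bracket_add_right)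
    show "lie_bracket M x (lie_bracket M y z) \<oplus>\<^bsub>M\<^esub> lie_bracket M y (lie_bracket M z x)
        \<oplus>\<^bsub>M\<^esub> lie_bracket M z (lie_bracket M x y) = \<zero>\<^bsub>M\<^esub>"
      using u v w by (simp add: bracket L.jacobi zero)
  qed
qed

text \<open>Two elements are equal once their images under \<open>f\<close> and \<open>g\<close>
  agree, so every bracket identity may be tested in \<open>L\<close> and \<open>L'\<close>, where it
  holds. Two maps are used instead of one map into a product because \<open>direct_prod\<close> is
  formed from topological Lie records, whereas \<open>der K \<nn>\<close> has no topology.\<close>

lemma lie_algebra_jointly_injective:
  assumes M: "module K M" and L: "lie_algebra K L" and L': "lie_algebra K L'"
    and f: "lie_hom K M L f" and g: "lie_hom K M L' g"
    and inj: "\<And>x y. \<lbrakk>x \<in> carrier M; y \<in> carrier M; f x = f y; g x = g y\<rbrakk> \<Longrightarrow> x = y"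
    and closed: "\<And>x y. \<lbrakk>x \<in> carrier M; y \<in> carrier M\<rbrakk> \<Longrightarrow> lie_bracket M x y \<in> carrier M"
  shows "lie_algebra K M"
proof -
  interpret M: module K M by fact
  interpret L: lie_algebra K L by fact
  interpret L': lie_algebra K L' by fact
  have lin: "linear_map K M L f" "linear_map K M L' g"
    and fB: "\<And>x y. \<lbrakk>x \<in> carrier M; y \<in> carrier M\<rbrakk> \<Longrightarrow>
        f (lie_bracket M x y) = lie_bracket L (f x) (f y)"
    and gB: "\<And>x y. \<lbrakk>x \<in> carrier M; y \<in> carrier M\<rbrakk> \<Longrightarrow>
        g (lie_bracket M x y) = lie_bracket L' (g x) (g y)"
    using f g unfolding lie_hom_def by auto
  note hom = linear_mapD[OF lin(1)] linear_mapD[OF lin(2)] fB gB closed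
    linear_map_zero[OF M.abelian_group_axioms L.abelian_group_axioms lin(1)]
    linear_map_zero[OF M.abelian_group_axioms L'.abelian_group_axioms lin(2)]
  \<comment> \<open>The first alternative tests an identity after both maps; the second serves
    closure under the bracket, the one axiom that is not an equation.\<close>
  show ?thesis
    by (intro lie_algebra.intro lie_algebra_axioms.intro M L.field_axioms)
      (rule inj;
       simp add: hom L.bracket_closed L'.bracket_closed L.bracket_add_left L'.bracket_add_left
        L.bracket_add_right L'.bracket_add_right L.bracket_smult_left L'.bracket_smult_left
        L.bracket_smult_right L'.bracket_smult_right L.bracket_self L'.bracket_self
        L.jacobi L'.jacobi | simp add: closed)+
qed

section \<open>Consequences of the Lie algebra axioms\<close>

context lie_algebra
begin

lemma bracket_linear_right: "x \<in> carrier L \<Longrightarrow> linear_map K L L (lie_bracket L x)"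
  by (intro linear_mapI bracket_closed bracket_add_right bracket_smult_right)

lemma bracket_linear_left: "y \<in> carrier L \<Longrightarrow> linear_map K L L (\<lambda>x. lie_bracket L x y)"
  by (intro linear_mapI bracket_closed bracket_add_left bracket_smult_left)

lemma bracket_zero_right: "x \<in> carrier L \<Longrightarrow> lie_bracket L x \<zero>\<^bsub>L\<^esub> = \<zero>\<^bsub>L\<^esub>"
  by (rule linear_map_zero[OF M.abelian_group_axioms M.abelian_group_axioms bracket_linear_right])

lemma bracket_zero_left: "x \<in> carrier L \<Longrightarrow> lie_bracket L \<zero>\<^bsub>L\<^esub> x = \<zero>\<^bsub>L\<^esub>"
  by (rule linear_map_zero[OF M.abelian_group_axioms M.abelian_group_axioms bracket_linear_left])

lemma bracket_minus_right:
  "\<lbrakk>x \<in> carrier L; y \<in> carrier L; z \<in> carrier L\<rbrakk> \<Longrightarrow>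
    lie_bracket L x (y \<ominus>\<^bsub>L\<^esub> z) = lie_bracket L x y \<ominus>\<^bsub>L\<^esub> lie_bracket L x z"
  by (rule linear_map_minus[OF M.abelian_group_axioms M.abelian_group_axioms bracket_linear_right])

lemma bracket_minus_left:
  "\<lbrakk>x \<in> carrier L; y \<in> carrier L; z \<in> carrier L\<rbrakk> \<Longrightarrow>
    lie_bracket L (x \<ominus>\<^bsub>L\<^esub> y) z = lie_bracket L x z \<ominus>\<^bsub>L\<^esub> lie_bracket L y z"
  by (rule linear_map_minus[OF M.abelian_group_axioms M.abelian_group_axioms bracket_linear_left])

lemma bracket_antisym:
  assumes x: "x \<in> carrier L" and y: "y \<in> carrier L"
  shows "lie_bracket L x y = \<ominus>\<^bsub>L\<^esub> lie_bracket L y x"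
proof -
  have "lie_bracket L x y \<oplus>\<^bsub>L\<^esub> lie_bracket L y x = lie_bracket L (x \<oplus>\<^bsub>L\<^esub> y) (x \<oplus>\<^bsub>L\<^esub> y)"
    unfolding bracket_add_left[OF x y M.a_closed[OF x y]]
    using assms by (simp add: bracket_add_right bracket_self bracket_closed)
  also have "\<dots> = \<zero>\<^bsub>L\<^esub>"
    using assms by (intro bracket_self) simp
  finally have "lie_bracket L x y \<oplus>\<^bsub>L\<^esub> lie_bracket L y x = \<zero>\<^bsub>L\<^esub>" .
  then show ?thesis
    using assms by (metis M.minus_equality bracket_closed)
qed

text \<open>The Jacobi identity in the form that makes \<open>ad L x\<close> a derivation.\<close>

lemma jacobi_derivation:
  assumes "x \<in> carrier L" "y \<in> carrier L" "z \<in> carrier L"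
  shows "lie_bracket L x (lie_bracket L y z) =
    lie_bracket L (lie_bracket L x y) z \<oplus>\<^bsub>L\<^esub> lie_bracket L y (lie_bracket L x z)"
proof -
  have 1: "lie_bracket L y (lie_bracket L z x) = \<ominus>\<^bsub>L\<^esub> lie_bracket L y (lie_bracket L x z)"
    using assms
    by (simp add: bracket_antisym[of z x] bracket_closed
      linear_map_uminus[OF M.abelian_group_axioms M.abelian_group_axioms bracket_linear_right])
  have 2: "lie_bracket L z (lie_bracket L x y) = \<ominus>\<^bsub>L\<^esub> lie_bracket L (lie_bracket L x y) z"
    using assms by (simp add: bracket_antisym[of z] bracket_closed)
  have cancel: "a = c \<oplus>\<^bsub>L\<^esub> b"
    if "a \<oplus>\<^bsub>L\<^esub> \<ominus>\<^bsub>L\<^esub> b \<oplus>\<^bsub>L\<^esub> \<ominus>\<^bsub>L\<^esub> c = \<zero>\<^bsub>L\<^esub>" "a \<in> carrier L" "b \<in> carrier L" "c \<in> carrier L" for a b c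
  proof -
    \<comment> \<open>The \<open>algebra\<close> call gets only the carrier memberships, so
      \<open>a\<close> is rewritten as the sum known to vanish plus the desired right-hand
      side.\<close>
    have "a = (a \<oplus>\<^bsub>L\<^esub> \<ominus>\<^bsub>L\<^esub> b \<oplus>\<^bsub>L\<^esub> \<ominus>\<^bsub>L\<^esub> c) \<oplus>\<^bsub>L\<^esub> (c \<oplus>\<^bsub>L\<^esub> b)"
      using that(2-) by algebra
    then show ?thesis using that by simp
  qed
  show ?thesis
    using jacobi[OF assms] assms unfolding 1 2 by (intro cancel) (simp_all add: bracket_closed)
qed

end


section \<open>Continuity of the operations\<close>

context topological_vector_space
begin

lemma continuous_map_vadd:
  assumes "continuous_map X (lie_top V) f" "continuous_map X (lie_top V) g"
  shows "continuous_map X (lie_top V) (\<lambda>x. f x \<oplus>\<^bsub>V\<^esub> g x)"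
  using continuous_map_compose[OF continuous_map_pairedI[OF assms] continuous_vadd]
  by (simp add: o_def)

lemma continuous_map_smult:
  assumes "continuous_map X (ring_top K) c" "continuous_map X (lie_top V) f"
  shows "continuous_map X (lie_top V) (\<lambda>x. c x \<odot>\<^bsub>V\<^esub> f x)"
  using continuous_map_compose[OF continuous_map_pairedI[OF assms] continuous_smult]
  by (simp add: o_def)

lemma continuous_map_smult_const:
  assumes "c \<in> carrier K" "continuous_map X (lie_top V) f"
  shows "continuous_map X (lie_top V) (\<lambda>x. c \<odot>\<^bsub>V\<^esub> f x)"
  using assms by (intro continuous_map_smult) (simp_all add: topspace_ring_top)

lemma continuous_map_carrier:
  "\<lbrakk>continuous_map X (lie_top V) f; x \<in> topspace X\<rbrakk> \<Longrightarrow> f x \<in> carrier V"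
  unfolding topspace_lie_top[symmetric] by (auto simp: continuous_map_def)

text \<open>Continuity of negation is not among the axioms of
  \<open>topological_vector_space\<close>; it comes from scalar multiplication by -1.\<close>

lemma continuous_map_vminus:
  assumes "continuous_map X (lie_top V) f" "continuous_map X (lie_top V) g"
  shows "continuous_map X (lie_top V) (\<lambda>x. f x \<ominus>\<^bsub>V\<^esub> g x)"
proof (rule continuous_map_eq)
  show "continuous_map X (lie_top V) (\<lambda>x. f x \<oplus>\<^bsub>V\<^esub> (\<ominus>\<^bsub>K\<^esub> \<one>\<^bsub>K\<^esub>) \<odot>\<^bsub>V\<^esub> g x)"
    using assms by (intro continuous_map_vadd continuous_map_smult_const) simp_all
  show "f x \<oplus>\<^bsub>V\<^esub> (\<ominus>\<^bsub>K\<^esub> \<one>\<^bsub>K\<^esub>) \<odot>\<^bsub>V\<^esub> g x = f x \<ominus>\<^bsub>V\<^esub> g x" if "x \<in> topspace X" for x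
    using continuous_map_carrier[OF assms(2) that] by (simp add: smult_l_minus M.minus_eq)
qed

end

lemma (in topological_lie_algebra) continuous_map_bracket:
  assumes "continuous_map X (lie_top L) f" "continuous_map X (lie_top L) g"
  shows "continuous_map X (lie_top L) (\<lambda>x. lie_bracket L (f x) (g x))"
  using continuous_map_compose[OF continuous_map_pairedI[OF assms] continuous_bracket]
  by (simp add: o_def)


section \<open>The Lie algebra of continuous derivations\<close>

text \<open>Adds no assumption: it fixes \<open>L\<close> to the record type without further fields,
  for which \<open>der\<close>, \<open>ad\<close>, \<open>center\<close> and \<open>quot\<close> are
  defined.\<close>

locale tla = topological_lie_algebra K L
  for K :: "('k, 'c) topological_ring_scheme" (structure) and L :: "('k, 'v) top_lie" (structure)
begin

lemma der_apply:
  assumes "u \<in> carrier L"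
  shows "\<zero>\<^bsub>der K L\<^esub> u = \<zero>\<^bsub>L\<^esub>"
    and "(D \<oplus>\<^bsub>der K L\<^esub> E) u = D u \<oplus>\<^bsub>L\<^esub> E u"
    and "(c \<odot>\<^bsub>der K L\<^esub> D) u = c \<odot>\<^bsub>L\<^esub> D u"
    and "lie_bracket (der K L) D E u = D (E u) \<ominus>\<^bsub>L\<^esub> E (D u)"
  using assms by (simp_all add: der_def)

lemma der_extensional:
  "\<zero>\<^bsub>der K L\<^esub> \<in> extensional (carrier L)"
  "D \<oplus>\<^bsub>der K L\<^esub> E \<in> extensional (carrier L)"
  "c \<odot>\<^bsub>der K L\<^esub> D \<in> extensional (carrier L)"
  "lie_bracket (der K L) D E \<in> extensional (carrier L)"
  by (simp_all add: der_def)

lemma derD: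
  assumes "D \<in> carrier (der K L)"
  shows "D \<in> extensional (carrier L)"
    and "linear_map K L L D"
    and "u \<in> carrier L \<Longrightarrow> D u \<in> carrier L"
    and "\<lbrakk>u \<in> carrier L; v \<in> carrier L\<rbrakk> \<Longrightarrow> D (u \<oplus>\<^bsub>L\<^esub> v) = D u \<oplus>\<^bsub>L\<^esub> D v"
    and "\<lbrakk>a \<in> carrier K; u \<in> carrier L\<rbrakk> \<Longrightarrow> D (a \<odot>\<^bsub>L\<^esub> u) = a \<odot>\<^bsub>L\<^esub> D u"
    and "\<lbrakk>u \<in> carrier L; v \<in> carrier L\<rbrakk> \<Longrightarrow>
      D (lie_bracket L u v) = lie_bracket L (D u) v \<oplus>\<^bsub>L\<^esub> lie_bracket L u (D v)"
    and "continuous_map (lie_top L) (lie_top L) D"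
    and "\<lbrakk>u \<in> carrier L; v \<in> carrier L\<rbrakk> \<Longrightarrow> D (u \<ominus>\<^bsub>L\<^esub> v) = D u \<ominus>\<^bsub>L\<^esub> D v"
    and "D \<zero>\<^bsub>L\<^esub> = \<zero>\<^bsub>L\<^esub>"
proof -
  show lin: "linear_map K L L D"
    using assms by (simp add: der_def continuous_linear_map_def)
  show "\<lbrakk>u \<in> carrier L; v \<in> carrier L\<rbrakk> \<Longrightarrow> D (u \<ominus>\<^bsub>L\<^esub> v) = D u \<ominus>\<^bsub>L\<^esub> D v"
    by (rule linear_map_minus[OF M.abelian_group_axioms M.abelian_group_axioms lin])
  show "D \<zero>\<^bsub>L\<^esub> = \<zero>\<^bsub>L\<^esub>"
    by (rule linear_map_zero[OF M.abelian_group_axioms M.abelian_group_axioms lin])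
qed (use assms in \<open>auto simp: der_def continuous_linear_map_def linear_map_def\<close>)

text \<open>Here \<open>D\<close> is meant to be a restricted function built by an operation of
  \<open>der\<close>, and \<open>f\<close> its bare formula. The conditions are checked on
  \<open>f\<close>; they transfer because only values on the carrier, which is the topological
  space, matter.\<close>

lemma derI:
  assumes "D \<in> extensional (carrier L)"
    and apply_eq: "\<And>u. u \<in> carrier L \<Longrightarrow> D u = f u"
    and "\<And>u. u \<in> carrier L \<Longrightarrow> f u \<in> carrier L"
    and "\<And>u v. \<lbrakk>u \<in> carrier L; v \<in> carrier L\<rbrakk> \<Longrightarrow> f (u \<oplus>\<^bsub>L\<^esub> v) = f u \<oplus>\<^bsub>L\<^esub> f v"
    and "\<And>a u. \<lbrakk>a \<in> carrier K; u \<in> carrier L\<rbrakk> \<Longrightarrow> f (a \<odot>\<^bsub>L\<^esub> u) = a \<odot>\<^bsub>L\<^esub> f u"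
    and "\<And>u v. \<lbrakk>u \<in> carrier L; v \<in> carrier L\<rbrakk> \<Longrightarrow>
      f (lie_bracket L u v) = lie_bracket L (f u) v \<oplus>\<^bsub>L\<^esub> lie_bracket L u (f v)"
    and "continuous_map (lie_top L) (lie_top L) f"
  shows "D \<in> carrier (der K L)"
proof -
  have "continuous_map (lie_top L) (lie_top L) D"
    using assms(7) by (rule continuous_map_eq) (simp add: apply_eq topspace_lie_top)
  then show ?thesis
    using assms
    by (auto simp: der_def continuous_linear_map_def bracket_closed intro!: linear_mapI)
qed

lemma der_eqI:
  assumes "D \<in> extensional (carrier L)" "E \<in> extensional (carrier L)"
    and "\<And>u. u \<in> carrier L \<Longrightarrow> D u = E u"
  shows "D = E"
  using assms by (rule extensionalityI)

lemma der_add_closed: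
  assumes D: "D \<in> carrier (der K L)" and E: "E \<in> carrier (der K L)"
  shows "D \<oplus>\<^bsub>der K L\<^esub> E \<in> carrier (der K L)"
proof (rule derI[OF der_extensional(2) der_apply(2)])
  fix u v assume u: "u \<in> carrier L" and v: "v \<in> carrier L"
  note uv = u v derD(3)[OF D u] derD(3)[OF E u] derD(3)[OF D v] derD(3)[OF E v]
  show "D (u \<oplus>\<^bsub>L\<^esub> v) \<oplus>\<^bsub>L\<^esub> E (u \<oplus>\<^bsub>L\<^esub> v) = D u \<oplus>\<^bsub>L\<^esub> E u \<oplus>\<^bsub>L\<^esub> (D v \<oplus>\<^bsub>L\<^esub> E v)"
    using uv unfolding derD(4)[OF D u v] derD(4)[OF E u v] by algebra
  show "D (lie_bracket L u v) \<oplus>\<^bsub>L\<^esub> E (lie_bracket L u v) =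
      lie_bracket L (D u \<oplus>\<^bsub>L\<^esub> E u) v \<oplus>\<^bsub>L\<^esub> lie_bracket L u (D v \<oplus>\<^bsub>L\<^esub> E v)"
    using uv
    by (simp add: derD(6)[OF D] derD(6)[OF E] bracket_add_left bracket_add_right bracket_closed
      M.add.m_ac)
qed (auto simp: derD[OF D] derD[OF E] smult_r_distr
  intro!: continuous_map_vadd derD(7)[OF D] derD(7)[OF E])

lemma der_smult_closed:
  assumes D: "D \<in> carrier (der K L)" and c: "c \<in> carrier K"
  shows "c \<odot>\<^bsub>der K L\<^esub> D \<in> carrier (der K L)"
proof (rule derI[OF der_extensional(3) der_apply(3)])
  fix a u assume a: "a \<in> carrier K" and u: "u \<in> carrier L"
  show "c \<odot>\<^bsub>L\<^esub> D (a \<odot>\<^bsub>L\<^esub> u) = a \<odot>\<^bsub>L\<^esub> (c \<odot>\<^bsub>L\<^esub> D u)"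
    using a u c derD(3)[OF D u]
    by (simp add: derD(5)[OF D] smult_assoc1[symmetric] R.m_comm)
next
  fix u v assume "u \<in> carrier L" and "v \<in> carrier L"
  then show "c \<odot>\<^bsub>L\<^esub> D (lie_bracket L u v) =
      lie_bracket L (c \<odot>\<^bsub>L\<^esub> D u) v \<oplus>\<^bsub>L\<^esub> lie_bracket L u (c \<odot>\<^bsub>L\<^esub> D v)"
    using c derD(3)[OF D]
    by (simp add: derD(6)[OF D] smult_r_distr bracket_smult_left bracket_smult_right bracket_closed)
qed (use c in \<open>auto simp: derD[OF D] smult_r_distr
  intro!: continuous_map_smult_const derD(7)[OF D]\<close>)

lemma der_bracket_closed:
  assumes D: "D \<in> carrier (der K L)" and E: "E \<in> carrier (der K L)"
  shows "lie_bracket (der K L) D E \<in> carrier (der K L)"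
proof (rule derI[OF der_extensional(4) der_apply(4)])
  note closed = derD(3)[OF D] derD(3)[OF E]
  fix u v assume u: "u \<in> carrier L" and v: "v \<in> carrier L"
  note uv = closed[OF u] closed[OF v]
  note uv2 = u v uv uv[THEN closed(1)] uv[THEN closed(2)]
  show "D (E (u \<oplus>\<^bsub>L\<^esub> v)) \<ominus>\<^bsub>L\<^esub> E (D (u \<oplus>\<^bsub>L\<^esub> v)) =
      D (E u) \<ominus>\<^bsub>L\<^esub> E (D u) \<oplus>\<^bsub>L\<^esub> (D (E v) \<ominus>\<^bsub>L\<^esub> E (D v))"
    using uv2
    unfolding derD(4)[OF D u v] derD(4)[OF E u v] derD(4)[OF D uv(2,4)] derD(4)[OF E uv(1,3)]
    by algebra
  \<comment> \<open>The letters b and c stand for the mixed terms [E u, D v] and [D u, E v]. Both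
    occur in D (E [u, v]) and in E (D [u, v]), so they drop out of the commutator.\<close>
  have cancel: "a \<oplus>\<^bsub>L\<^esub> b \<oplus>\<^bsub>L\<^esub> (c \<oplus>\<^bsub>L\<^esub> d) \<ominus>\<^bsub>L\<^esub> (e \<oplus>\<^bsub>L\<^esub> c \<oplus>\<^bsub>L\<^esub> (b \<oplus>\<^bsub>L\<^esub> f)) = a \<ominus>\<^bsub>L\<^esub> e \<oplus>\<^bsub>L\<^esub> (d \<ominus>\<^bsub>L\<^esub> f)"
    if "a \<in> carrier L" "b \<in> carrier L" "c \<in> carrier L" "d \<in> carrier L" "e \<in> carrier L" "f \<in> carrier L"
    for a b c d e f
    using that by algebra
  show "D (E (lie_bracket L u v)) \<ominus>\<^bsub>L\<^esub> E (D (lie_bracket L u v)) =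
      lie_bracket L (D (E u) \<ominus>\<^bsub>L\<^esub> E (D u)) v \<oplus>\<^bsub>L\<^esub> lie_bracket L u (D (E v) \<ominus>\<^bsub>L\<^esub> E (D v))"
    using uv2
    by (simp add: derD(4,6)[OF D] derD(4,6)[OF E] bracket_minus_left bracket_minus_right
      bracket_closed cancel)
next
  fix a u assume a: "a \<in> carrier K" and u: "u \<in> carrier L"
  then show "D (E (a \<odot>\<^bsub>L\<^esub> u)) \<ominus>\<^bsub>L\<^esub> E (D (a \<odot>\<^bsub>L\<^esub> u)) = a \<odot>\<^bsub>L\<^esub> (D (E u) \<ominus>\<^bsub>L\<^esub> E (D u))"
    by (simp add: derD(3,5)[OF D] derD(3,5)[OF E] M.minus_eq smult_r_distr smult_r_minus)
next
  show "continuous_map (lie_top L) (lie_top L) (\<lambda>u. D (E u) \<ominus>\<^bsub>L\<^esub> E (D u))"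
    using continuous_map_compose[OF derD(7)[OF E] derD(7)[OF D]]
      continuous_map_compose[OF derD(7)[OF D] derD(7)[OF E]]
    by (intro continuous_map_vminus) (simp_all add: o_def)
qed (auto intro!: M.minus_closed derD(3)[OF D] derD(3)[OF E])

lemma der_zero_closed: "\<zero>\<^bsub>der K L\<^esub> \<in> carrier (der K L)"
  by (rule derI[OF der_extensional(1) der_apply(1)])
    (simp_all add: bracket_zero_left bracket_zero_right topspace_lie_top)

lemma der_abelian_group: "abelian_group (der K L)"
proof (rule abelian_groupI)
  fix D assume D: "D \<in> carrier (der K L)"
  show "\<zero>\<^bsub>der K L\<^esub> \<oplus>\<^bsub>der K L\<^esub> D = D"
    by (rule der_eqI) (simp_all add: der_extensional der_apply derD[OF D])
  show "\<exists>E\<in>carrier (der K L). E \<oplus>\<^bsub>der K L\<^esub> D = \<zero>\<^bsub>der K L\<^esub>"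
  proof
    show "(\<ominus>\<^bsub>K\<^esub> \<one>\<^bsub>K\<^esub>) \<odot>\<^bsub>der K L\<^esub> D \<in> carrier (der K L)"
      using D by (intro der_smult_closed) simp_all
    show "(\<ominus>\<^bsub>K\<^esub> \<one>\<^bsub>K\<^esub>) \<odot>\<^bsub>der K L\<^esub> D \<oplus>\<^bsub>der K L\<^esub> D = \<zero>\<^bsub>der K L\<^esub>"
      by (rule der_eqI)
        (simp_all add: der_extensional der_apply derD(3)[OF D] smult_l_minus M.l_neg)
  qed
  fix E assume E: "E \<in> carrier (der K L)"
  show "D \<oplus>\<^bsub>der K L\<^esub> E = E \<oplus>\<^bsub>der K L\<^esub> D"
    by (rule der_eqI)
      (simp_all add: der_extensional der_apply derD(3)[OF D] derD(3)[OF E] M.a_comm)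
  fix F assume F: "F \<in> carrier (der K L)"
  show "D \<oplus>\<^bsub>der K L\<^esub> E \<oplus>\<^bsub>der K L\<^esub> F = D \<oplus>\<^bsub>der K L\<^esub> (E \<oplus>\<^bsub>der K L\<^esub> F)"
    by (rule der_eqI)
      (simp_all add: der_extensional der_apply derD(3)[OF D] derD(3)[OF E] derD(3)[OF F] M.a_assoc)
qed (simp_all add: der_zero_closed der_add_closed)

lemma der_module: "module K (der K L)"
proof (rule moduleI[OF R.is_cring der_abelian_group])
  fix D assume D: "D \<in> carrier (der K L)"
  show "\<one>\<^bsub>K\<^esub> \<odot>\<^bsub>der K L\<^esub> D = D"
    by (rule der_eqI) (simp_all add: der_extensional der_apply derD[OF D])
  fix a assume a: "a \<in> carrier K"
  show "a \<odot>\<^bsub>der K L\<^esub> D \<in> carrier (der K L)"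
    using D a by (rule der_smult_closed)
  {
    fix b assume b: "b \<in> carrier K"
    show "(a \<oplus>\<^bsub>K\<^esub> b) \<odot>\<^bsub>der K L\<^esub> D = a \<odot>\<^bsub>der K L\<^esub> D \<oplus>\<^bsub>der K L\<^esub> b \<odot>\<^bsub>der K L\<^esub> D"
      using a b by (intro der_eqI) (simp_all add: der_extensional der_apply derD(3)[OF D] smult_l_distr)
    show "a \<otimes>\<^bsub>K\<^esub> b \<odot>\<^bsub>der K L\<^esub> D = a \<odot>\<^bsub>der K L\<^esub> (b \<odot>\<^bsub>der K L\<^esub> D)"
      using a b by (intro der_eqI) (simp_all add: der_extensional der_apply derD(3)[OF D] smult_assoc1)
  }
  fix E assume E: "E \<in> carrier (der K L)"
  show "a \<odot>\<^bsub>der K L\<^esub> (D \<oplus>\<^bsub>der K L\<^esub> E) = a \<odot>\<^bsub>der K L\<^esub> D \<oplus>\<^bsub>der K L\<^esub> a \<odot>\<^bsub>der K L\<^esub> E"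
    using a
    by (intro der_eqI)
      (simp_all add: der_extensional der_apply derD(3)[OF D] derD(3)[OF E] smult_r_distr)
qed

lemma der_lie_algebra: "lie_algebra K (der K L)"
proof (intro lie_algebra.intro lie_algebra_axioms.intro der_module field_axioms der_bracket_closed)
  fix D assume D: "D \<in> carrier (der K L)"
  show "lie_bracket (der K L) D D = \<zero>\<^bsub>der K L\<^esub>"
    by (rule der_eqI) (simp_all add: der_extensional der_apply derD(3)[OF D] M.minus_eq M.r_neg)
  fix E assume E: "E \<in> carrier (der K L)"
  {
    fix c assume c: "c \<in> carrier K"
    show "lie_bracket (der K L) (c \<odot>\<^bsub>der K L\<^esub> D) E = c \<odot>\<^bsub>der K L\<^esub> lie_bracket (der K L) D E"
      using c
      by (intro der_eqI) (simp_all add: der_extensional der_apply derD(3,5)[OF D] derD(3,5)[OF E]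
        M.minus_eq smult_r_distr smult_r_minus)
    show "lie_bracket (der K L) D (c \<odot>\<^bsub>der K L\<^esub> E) = c \<odot>\<^bsub>der K L\<^esub> lie_bracket (der K L) D E"
      using c
      by (intro der_eqI) (simp_all add: der_extensional der_apply derD(3,5)[OF D] derD(3,5)[OF E]
        M.minus_eq smult_r_distr smult_r_minus)
  }
  fix F assume F: "F \<in> carrier (der K L)"
  note closed = derD(3)[OF D] derD(3)[OF E] derD(3)[OF F]
  have regroup: "a \<oplus>\<^bsub>L\<^esub> b \<ominus>\<^bsub>L\<^esub> (c \<oplus>\<^bsub>L\<^esub> d) = a \<ominus>\<^bsub>L\<^esub> c \<oplus>\<^bsub>L\<^esub> (b \<ominus>\<^bsub>L\<^esub> d)"
    if "a \<in> carrier L" "b \<in> carrier L" "c \<in> carrier L" "d \<in> carrier L" for a b c d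
    using that by algebra
  show "lie_bracket (der K L) (D \<oplus>\<^bsub>der K L\<^esub> E) F =
      lie_bracket (der K L) D F \<oplus>\<^bsub>der K L\<^esub> lie_bracket (der K L) E F"
    by (rule der_eqI) (simp_all add: der_extensional der_apply closed derD(4)[OF F] regroup)
  show "lie_bracket (der K L) D (E \<oplus>\<^bsub>der K L\<^esub> F) =
      lie_bracket (der K L) D E \<oplus>\<^bsub>der K L\<^esub> lie_bracket (der K L) D F"
    by (rule der_eqI) (simp_all add: der_extensional der_apply closed derD(4)[OF D] regroup)
  \<comment> \<open>The six letters are the values at one point of the composites of D, E, F in the
    six orders. Each occurs twice, with opposite signs.\<close>
  have cancel: "a \<ominus>\<^bsub>L\<^esub> b \<ominus>\<^bsub>L\<^esub> (c \<ominus>\<^bsub>L\<^esub> d) \<oplus>\<^bsub>L\<^esub> (c \<ominus>\<^bsub>L\<^esub> e \<ominus>\<^bsub>L\<^esub> (f \<ominus>\<^bsub>L\<^esub> b))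
      \<oplus>\<^bsub>L\<^esub> (f \<ominus>\<^bsub>L\<^esub> d \<ominus>\<^bsub>L\<^esub> (a \<ominus>\<^bsub>L\<^esub> e)) = \<zero>\<^bsub>L\<^esub>"
    if "a \<in> carrier L" "b \<in> carrier L" "c \<in> carrier L" "d \<in> carrier L" "e \<in> carrier L" "f \<in> carrier L"
    for a b c d e f
    using that by algebra
  show "lie_bracket (der K L) D (lie_bracket (der K L) E F)
      \<oplus>\<^bsub>der K L\<^esub> lie_bracket (der K L) E (lie_bracket (der K L) F D)
      \<oplus>\<^bsub>der K L\<^esub> lie_bracket (der K L) F (lie_bracket (der K L) D E) = \<zero>\<^bsub>der K L\<^esub>"
    by (rule der_eqI) (simp_all add: der_extensional der_apply closed derD(8)[OF D] derD(8)[OF E]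
      derD(8)[OF F] cancel)
qed

subsection \<open>Inner derivations\<close>

lemma ad_apply: "v \<in> carrier L \<Longrightarrow> ad L u v = lie_bracket L u v"
  by (simp add: ad_def)

lemma ad_extensional: "ad L u \<in> extensional (carrier L)"
  by (simp add: ad_def)

lemma ad_closed:
  assumes u: "u \<in> carrier L"
  shows "ad L u \<in> carrier (der K L)"
proof (rule derI[OF ad_extensional ad_apply])
  show "continuous_map (lie_top L) (lie_top L) (lie_bracket L u)"
    using u by (intro continuous_map_bracket) (simp_all add: topspace_lie_top)
qed (use u in \<open>auto intro!: bracket_closed bracket_add_right bracket_smult_right jacobi_derivation\<close>)

lemma ad_linear: "linear_map K L (der K L) (ad L)"
  by (rule linear_mapI, erule ad_closed; intro der_eqI)
    (simp_all add: der_extensional ad_extensional der_apply ad_apply bracket_add_left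
      bracket_smult_left)

text \<open>Subtracting [u, D v] from D [u, v] leaves [D u, v]. So inner derivations form an ideal,
  which keeps all correction terms in the bracket of \<open>gS\<close> inner; the case of an inner
  \<open>D\<close> says that \<open>ad\<close> respects brackets.\<close>

lemma der_bracket_ad:
  assumes D: "D \<in> carrier (der K L)" and u: "u \<in> carrier L"
  shows "lie_bracket (der K L) D (ad L u) = ad L (D u)"
proof (rule der_eqI[OF der_extensional(4) ad_extensional])
  fix v assume v: "v \<in> carrier L"
  have "a \<oplus>\<^bsub>L\<^esub> b \<ominus>\<^bsub>L\<^esub> b = a" if "a \<in> carrier L" "b \<in> carrier L" for a b
    using that by algebra
  then show "lie_bracket (der K L) D (ad L u) v = ad L (D u) v"
    using u v by (simp add: der_apply ad_apply derD(3,6)[OF D] bracket_closed)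
qed

lemma ad_bracket:
  "\<lbrakk>u \<in> carrier L; v \<in> carrier L\<rbrakk> \<Longrightarrow>
    lie_bracket (der K L) (ad L u) (ad L v) = ad L (lie_bracket L u v)"
  by (simp add: der_bracket_ad ad_closed ad_apply)

lemma ad_add: "\<lbrakk>u \<in> carrier L; v \<in> carrier L\<rbrakk> \<Longrightarrow> ad L (u \<oplus>\<^bsub>L\<^esub> v) = ad L u \<oplus>\<^bsub>der K L\<^esub> ad L v"
  by (rule linear_mapD[OF ad_linear])

lemma ad_minus: "\<lbrakk>u \<in> carrier L; v \<in> carrier L\<rbrakk> \<Longrightarrow> ad L (u \<ominus>\<^bsub>L\<^esub> v) = ad L u \<ominus>\<^bsub>der K L\<^esub> ad L v"
  by (rule linear_map_minus[OF M.abelian_group_axioms der_abelian_group ad_linear])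

lemma center_eq_ker_ad: "center L = a_kernel L (der K L) (ad L)"
proof -
  have "(\<forall>x\<in>carrier L. lie_bracket L z x = \<zero>\<^bsub>L\<^esub>) \<longleftrightarrow> ad L z = \<zero>\<^bsub>der K L\<^esub>" for z
  proof
    assume "\<forall>x\<in>carrier L. lie_bracket L z x = \<zero>\<^bsub>L\<^esub>"
    then show "ad L z = \<zero>\<^bsub>der K L\<^esub>"
      by (intro der_eqI) (simp_all add: der_extensional ad_extensional der_apply ad_apply)
  next
    assume "ad L z = \<zero>\<^bsub>der K L\<^esub>"
    then show "\<forall>x\<in>carrier L. lie_bracket L z x = \<zero>\<^bsub>L\<^esub>"
      by (metis ad_apply der_apply(1))
  qed
  then show ?thesis
    by (simp add: center_def a_kernel_def')
qed

end


section \<open>Quotients\<close>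

text \<open>Every point of an open set has an open rectangle around it inside the set, and the image
  of a rectangle is the rectangle of the images.\<close>

lemma open_map_map_prod:
  assumes f: "open_map X X' f" and g: "open_map Y Y' g"
  shows "open_map (prod_topology X Y) (prod_topology X' Y') (map_prod f g)"
  unfolding open_map_def
proof (intro allI impI)
  fix U assume U: "openin (prod_topology X Y) U"
  show "openin (prod_topology X' Y') (map_prod f g ` U)"
    unfolding openin_prod_topology_alt
  proof (intro allI impI)
    fix a b assume "(a, b) \<in> map_prod f g ` U"
    then obtain x y where xy: "(x, y) \<in> U" "a = f x" "b = g y" by auto
    then obtain A B where AB: "openin X A" "openin Y B" "x \<in> A" "y \<in> B" "A \<times> B \<subseteq> U"
      using U[unfolded openin_prod_topology_alt, rule_format, OF xy(1)] by (elim exE conjE)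
    have "f ` A \<times> g ` B = map_prod f g ` (A \<times> B)"
      by (rule map_prod_surj_on[OF refl refl, symmetric])
    then have "f ` A \<times> g ` B \<subseteq> map_prod f g ` U"
      using AB(5) by (simp add: image_mono)
    moreover have "openin X' (f ` A)" "openin Y' (g ` B)"
      using f g AB(1,2) by (simp_all add: open_map_def)
    ultimately show "\<exists>A B. openin X' A \<and> openin Y' B \<and> a \<in> A \<and> b \<in> B \<and> A \<times> B \<subseteq> map_prod f g ` U"
      using AB(3,4) xy(2,3) by (intro exI conjI) (assumption | simp)+
  qed
qed

text \<open>Unlike quotient maps, open quotient maps are stable under products.\<close>

definition open_quotient_map :: "'a topology \<Rightarrow> 'b topology \<Rightarrow> ('a \<Rightarrow> 'b) \<Rightarrow> bool"
  where "open_quotient_map X Y f \<longleftrightarrow> quotient_map X Y f \<and> open_map X Y f"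

lemma open_quotient_map_ident: "open_quotient_map X X (\<lambda>x. x)"
  using continuous_open_quotient_map[of X X "\<lambda>x. x"] by (simp add: open_quotient_map_def open_map_def)

lemma open_quotient_map_prod:
  assumes "open_quotient_map X X' f" "open_quotient_map Y Y' g"
  shows "open_quotient_map (prod_topology X Y) (prod_topology X' Y') (map_prod f g)"
proof -
  have f: "continuous_map X X' f" "open_map X X' f" "f ` topspace X = topspace X'"
    using assms(1) unfolding open_quotient_map_def
    by (auto simp: quotient_imp_continuous_map quotient_imp_surjective_map)
  have g: "continuous_map Y Y' g" "open_map Y Y' g" "g ` topspace Y = topspace Y'"
    using assms(2) unfolding open_quotient_map_def
    by (auto simp: quotient_imp_continuous_map quotient_imp_surjective_map)
  have "continuous_map (prod_topology X Y) (prod_topology X' Y') (map_prod f g)"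
    using f(1) g(1) unfolding map_prod_def continuous_map_prod_top by simp
  moreover have "map_prod f g ` topspace (prod_topology X Y) = topspace (prod_topology X' Y')"
    using f(3) g(3) by (simp add: map_prod_surj_on)
  ultimately show ?thesis
    using open_map_map_prod[OF f(2) g(2)]
    by (simp add: open_quotient_map_def continuous_open_quotient_map)
qed

lemma continuous_map_open_quotient:
  assumes "open_quotient_map X Y f" "continuous_map X Z (\<lambda>x. g (f x))"
  shows "continuous_map Y Z g"
  using assms continuous_compose_quotient_map[of X Y f Z g]
  by (simp add: open_quotient_map_def o_def)

lemma quot_simps:
  "carrier (quot V W) = a_rcosets\<^bsub>V\<^esub> W"
  "\<zero>\<^bsub>quot V W\<^esub> = W"
  "add (quot V W) = set_add V"
  "lie_top (quot V W) = quot_top V W"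
  by (simp_all add: quot_def)

locale tvs_quotient = topological_vector_space K V
  for K :: "('k, 'c) topological_ring_scheme" (structure) and V :: "('k, 'v) top_lie" (structure) +
  fixes W :: "'v set"
  assumes submodule: "submodule W K V"
begin

interpretation W: abelian_subgroup W V
  by (intro abelian_subgroupI3 additive_subgroup.intro M.abelian_group_axioms
    submodule.axioms(1)[OF submodule])

lemma subspace_mem:
  "\<zero>\<^bsub>V\<^esub> \<in> W"
  "w \<in> W \<Longrightarrow> w \<in> carrier V"
  "w \<in> W \<Longrightarrow> \<ominus>\<^bsub>V\<^esub> w \<in> W"
  by (simp_all add: W.a_Hcarr)

lemma coset_subset: "\<lbrakk>v \<in> carrier V; u \<in> W +>\<^bsub>V\<^esub> v\<rbrakk> \<Longrightarrow> u \<in> carrier V"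
  by (rule W.a_elemrcos_carrier)

lemma smult_mem: "\<lbrakk>c \<in> carrier K; w \<in> W\<rbrakk> \<Longrightarrow> c \<odot>\<^bsub>V\<^esub> w \<in> W"
  by (rule submodule.smult_closed[OF submodule])

lemma mem_coset_iff:
  "\<lbrakk>u \<in> carrier V; v \<in> carrier V\<rbrakk> \<Longrightarrow> u \<in> W +>\<^bsub>V\<^esub> v \<longleftrightarrow> u \<ominus>\<^bsub>V\<^esub> v \<in> W"
  by (simp add: W.a_rcos_module M.minus_eq)

lemma coset_eq_iff:
  assumes "u \<in> carrier V" "v \<in> carrier V"
  shows "W +>\<^bsub>V\<^esub> u = W +>\<^bsub>V\<^esub> v \<longleftrightarrow> u \<ominus>\<^bsub>V\<^esub> v \<in> W"
  using assms mem_coset_iff[OF assms] W.a_repr_independence'[of u v] W.a_rcos_self[of u] by metis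

lemma coset_zero: "W +>\<^bsub>V\<^esub> \<zero>\<^bsub>V\<^esub> = W"
  by (rule W.a_rcos_const) simp

lemma coset_eq_self_iff: "u \<in> carrier V \<Longrightarrow> W +>\<^bsub>V\<^esub> u = W \<longleftrightarrow> u \<in> W"
  using coset_eq_iff[of u "\<zero>\<^bsub>V\<^esub>"] coset_zero by (simp add: M.abelian_group_simprules)

lemma carrier_quot: "carrier (quot V W) = (\<lambda>v. W +>\<^bsub>V\<^esub> v) ` carrier V"
  by (auto simp: quot_simps A_RCOSETS_def')

lemma coset_closed: "v \<in> carrier V \<Longrightarrow> W +>\<^bsub>V\<^esub> v \<in> carrier (quot V W)"
  by (simp add: carrier_quot)

lemma quot_cases:
  assumes "X \<in> carrier (quot V W)"
  obtains v where "v \<in> carrier V" "X = W +>\<^bsub>V\<^esub> v"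
  using assms unfolding carrier_quot by blast

text \<open>The operations of \<open>quot\<close> and \<open>gS\<close> are unions over all
  representatives. Such a union collapses to its value at one representative as soon as
  \<open>F\<close> is constant on the coset, which is nonempty since it contains
  \<open>v\<close>.\<close>

lemma UN_coset:
  assumes v: "v \<in> carrier V"
    and "\<And>u. \<lbrakk>u \<in> carrier V; u \<ominus>\<^bsub>V\<^esub> v \<in> W\<rbrakk> \<Longrightarrow> F u = F v"
  shows "(\<Union>u\<in>W +>\<^bsub>V\<^esub> v. F u) = F v"
proof -
  have "(\<Union>u\<in>W +>\<^bsub>V\<^esub> v. F u) = (\<Union>u\<in>W +>\<^bsub>V\<^esub> v. F v)"
  proof (rule SUP_cong[OF refl])
    fix u assume u: "u \<in> W +>\<^bsub>V\<^esub> v"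
    have "u \<in> carrier V"
      using v u by (rule W.a_elemrcos_carrier)
    then show "F u = F v"
      using u mem_coset_iff[OF _ v] assms(2)[of u] by blast
  qed
  also have "\<dots> = F v"
    using W.a_rcos_self[OF v] by blast
  finally show ?thesis .
qed

lemma quot_add:
  "\<lbrakk>u \<in> carrier V; v \<in> carrier V\<rbrakk> \<Longrightarrow>
    (W +>\<^bsub>V\<^esub> u) \<oplus>\<^bsub>quot V W\<^esub> (W +>\<^bsub>V\<^esub> v) = W +>\<^bsub>V\<^esub> (u \<oplus>\<^bsub>V\<^esub> v)"
  by (simp add: quot_simps W.a_rcos_sum)

lemma quot_smult:
  assumes c: "c \<in> carrier K" and v: "v \<in> carrier V"
  shows "c \<odot>\<^bsub>quot V W\<^esub> (W +>\<^bsub>V\<^esub> v) = W +>\<^bsub>V\<^esub> (c \<odot>\<^bsub>V\<^esub> v)"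
proof -
  have "W +>\<^bsub>V\<^esub> (c \<odot>\<^bsub>V\<^esub> u) = W +>\<^bsub>V\<^esub> (c \<odot>\<^bsub>V\<^esub> v)" if "u \<in> carrier V" "u \<ominus>\<^bsub>V\<^esub> v \<in> W" for u
    using smult_mem[OF c that(2)] that c v
    by (simp add: coset_eq_iff M.minus_eq smult_r_distr smult_r_minus)
  then show ?thesis
    unfolding quot_def using UN_coset[OF v, of "\<lambda>u. W +>\<^bsub>V\<^esub> (c \<odot>\<^bsub>V\<^esub> u)"] by simp
qed

lemma coset_linear: "linear_map K V (quot V W) (\<lambda>v. W +>\<^bsub>V\<^esub> v)"
  by (intro linear_mapI) (simp_all add: coset_closed quot_add quot_smult)

lemma quot_module: "module K (quot V W)"
  using module_axioms coset_linear carrier_quot[symmetric]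
  by (rule module_image) (simp add: coset_zero quot_simps)

lemma openin_quot:
  "openin (lie_top (quot V W)) U \<longleftrightarrow>
    U \<subseteq> carrier (quot V W) \<and> openin (lie_top V) {v \<in> carrier V. W +>\<^bsub>V\<^esub> v \<in> U}"
proof -
  have "istopology (\<lambda>U. U \<subseteq> a_rcosets\<^bsub>V\<^esub> W \<and> openin (lie_top V) {v \<in> carrier V. W +>\<^bsub>V\<^esub> v \<in> U})"
    unfolding istopology_def
  proof (intro conjI allI impI; (elim conjE)?)
    fix S T
    assume "openin (lie_top V) {v \<in> carrier V. W +>\<^bsub>V\<^esub> v \<in> S}"
      and "openin (lie_top V) {v \<in> carrier V. W +>\<^bsub>V\<^esub> v \<in> T}"
    then have "openin (lie_top V)
        ({v \<in> carrier V. W +>\<^bsub>V\<^esub> v \<in> S} \<inter> {v \<in> carrier V. W +>\<^bsub>V\<^esub> v \<in> T})"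
      by (rule openin_Int)
    then show "openin (lie_top V) {v \<in> carrier V. W +>\<^bsub>V\<^esub> v \<in> S \<inter> T}"
      by (rule back_subst[where P = "openin (lie_top V)"]) auto
  next
    fix \<K>
    assume "\<forall>U\<in>\<K>. U \<subseteq> a_rcosets\<^bsub>V\<^esub> W \<and> openin (lie_top V) {v \<in> carrier V. W +>\<^bsub>V\<^esub> v \<in> U}"
    then have "openin (lie_top V) (\<Union>U\<in>\<K>. {v \<in> carrier V. W +>\<^bsub>V\<^esub> v \<in> U})"
      by (intro openin_Union) auto
    then show "openin (lie_top V) {v \<in> carrier V. W +>\<^bsub>V\<^esub> v \<in> \<Union>\<K>}"
      by (rule back_subst[where P = "openin (lie_top V)"]) auto
  qed blast+
  then show ?thesis
    by (simp add: quot_simps quot_top_def)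
qed

lemma topspace_quot: "topspace (lie_top (quot V W)) = carrier (quot V W)"
proof -
  have "{v \<in> carrier V. W +>\<^bsub>V\<^esub> v \<in> carrier (quot V W)} = topspace (lie_top V)"
    by (auto simp: coset_closed topspace_lie_top)
  then have "openin (lie_top (quot V W)) (carrier (quot V W))"
    unfolding openin_quot by (simp only: openin_topspace) simp
  then show ?thesis
    by (metis openin_quot openin_subset openin_topspace subset_antisym)
qed

lemma coset_continuous: "continuous_map (lie_top V) (lie_top (quot V W)) (\<lambda>v. W +>\<^bsub>V\<^esub> v)"
  by (auto simp: continuous_map_def topspace_quot openin_quot topspace_lie_top coset_closed)

text \<open>The preimage of the image of U is the union of the translates of U by elements of W, and
  each translate is open because subtracting a fixed vector is continuous.\<close>

lemma coset_open_map: "open_map (lie_top V) (lie_top (quot V W)) (\<lambda>v. W +>\<^bsub>V\<^esub> v)"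
  unfolding open_map_def
proof (intro allI impI)
  fix U assume U: "openin (lie_top V) U"
  then have Uc: "U \<subseteq> carrier V"
    using openin_subset topspace_lie_top by blast
  have "openin (lie_top V) (\<Union>w\<in>W. {v \<in> topspace (lie_top V). v \<ominus>\<^bsub>V\<^esub> w \<in> U})"
  proof (intro openin_Union)
    fix T assume "T \<in> (\<lambda>w. {v \<in> topspace (lie_top V). v \<ominus>\<^bsub>V\<^esub> w \<in> U}) ` W"
    then obtain w where w: "w \<in> W" "T = {v \<in> topspace (lie_top V). v \<ominus>\<^bsub>V\<^esub> w \<in> U}" by auto
    have "continuous_map (lie_top V) (lie_top V) (\<lambda>v. v \<ominus>\<^bsub>V\<^esub> w)"
      using w(1) by (intro continuous_map_vminus) (simp_all add: topspace_lie_top)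
    then show "openin (lie_top V) T"
      unfolding w(2) using U by (rule openin_continuous_map_preimage)
  qed
  moreover have "{v \<in> carrier V. W +>\<^bsub>V\<^esub> v \<in> (\<lambda>v. W +>\<^bsub>V\<^esub> v) ` U} =
      (\<Union>w\<in>W. {v \<in> topspace (lie_top V). v \<ominus>\<^bsub>V\<^esub> w \<in> U})"
  proof (intro equalityI subsetI)
    fix v assume "v \<in> {v \<in> carrier V. W +>\<^bsub>V\<^esub> v \<in> (\<lambda>v. W +>\<^bsub>V\<^esub> v) ` U}"
    then obtain u where u: "v \<in> carrier V" "u \<in> U" "u \<in> carrier V" "v \<ominus>\<^bsub>V\<^esub> u \<in> W"
      using Uc by (auto simp: coset_eq_iff subset_iff)
    have "v \<ominus>\<^bsub>V\<^esub> (v \<ominus>\<^bsub>V\<^esub> u) = u"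
      using u by algebra
    then show "v \<in> (\<Union>w\<in>W. {v \<in> topspace (lie_top V). v \<ominus>\<^bsub>V\<^esub> w \<in> U})"
      using u by (auto simp: topspace_lie_top intro!: bexI[of _ "v \<ominus>\<^bsub>V\<^esub> u"])
  next
    fix v assume "v \<in> (\<Union>w\<in>W. {v \<in> topspace (lie_top V). v \<ominus>\<^bsub>V\<^esub> w \<in> U})"
    then obtain w where w: "w \<in> W" "v \<in> carrier V" "v \<ominus>\<^bsub>V\<^esub> w \<in> U"
      by (auto simp: topspace_lie_top)
    then have wc: "w \<in> carrier V" by simp
    have "v \<ominus>\<^bsub>V\<^esub> (v \<ominus>\<^bsub>V\<^esub> w) = w"
      using w(2) wc by algebra
    then have "W +>\<^bsub>V\<^esub> v = W +>\<^bsub>V\<^esub> (v \<ominus>\<^bsub>V\<^esub> w)"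
      using w wc by (simp add: coset_eq_iff)
    then show "v \<in> {v \<in> carrier V. W +>\<^bsub>V\<^esub> v \<in> (\<lambda>v. W +>\<^bsub>V\<^esub> v) ` U}"
      using w by blast
  qed
  moreover have "(\<lambda>v. W +>\<^bsub>V\<^esub> v) ` U \<subseteq> carrier (quot V W)"
    using Uc coset_closed by auto
  ultimately show "openin (lie_top (quot V W)) ((\<lambda>v. W +>\<^bsub>V\<^esub> v) ` U)"
    by (simp add: openin_quot)
qed

lemma coset_open_quotient_map:
  "open_quotient_map (lie_top V) (lie_top (quot V W)) (\<lambda>v. W +>\<^bsub>V\<^esub> v)"
  using coset_open_map continuous_open_quotient_map[OF coset_continuous coset_open_map]
  by (simp add: open_quotient_map_def topspace_quot topspace_lie_top carrier_quot)

text \<open>Two points u, v lie in different cosets exactly if their difference avoids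
  \<open>W\<close>, an open condition on the pair when \<open>W\<close> is closed. A rectangle
  around (u, v) inside this open set projects to two disjoint sets, and these are open because the
  coset map is open.\<close>

lemma quot_Hausdorff:
  assumes "closedin (lie_top V) W"
  shows "Hausdorff_space (lie_top (quot V W))"
  unfolding Hausdorff_space_def
proof (intro allI impI, elim conjE)
  fix X Y
  assume "X \<in> topspace (lie_top (quot V W))" "Y \<in> topspace (lie_top (quot V W))" and XY: "X \<noteq> Y"
  then obtain u v where u: "u \<in> carrier V" "X = W +>\<^bsub>V\<^esub> u" and v: "v \<in> carrier V" "Y = W +>\<^bsub>V\<^esub> v"
    unfolding topspace_quot by (metis quot_cases)
  have "continuous_map (prod_topology (lie_top V) (lie_top V)) (lie_top V) (\<lambda>p. fst p \<ominus>\<^bsub>V\<^esub> snd p)"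
    by (intro continuous_map_vminus continuous_map_fst continuous_map_snd)
  moreover have "openin (lie_top V) (topspace (lie_top V) - W)"
    using assms by (simp add: closedin_def)
  ultimately have "openin (prod_topology (lie_top V) (lie_top V))
      {p \<in> topspace (prod_topology (lie_top V) (lie_top V)).
        fst p \<ominus>\<^bsub>V\<^esub> snd p \<in> topspace (lie_top V) - W}"
    by (rule openin_continuous_map_preimage)
  moreover have "(u, v) \<in> {p \<in> topspace (prod_topology (lie_top V) (lie_top V)).
        fst p \<ominus>\<^bsub>V\<^esub> snd p \<in> topspace (lie_top V) - W}"
    using u v XY by (simp add: topspace_lie_top coset_eq_iff)
  ultimately obtain A B where AB: "openin (lie_top V) A" "openin (lie_top V) B" "u \<in> A" "v \<in> B"
    "A \<times> B \<subseteq> {p \<in> topspace (prod_topology (lie_top V) (lie_top V)).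
        fst p \<ominus>\<^bsub>V\<^esub> snd p \<in> topspace (lie_top V) - W}"
    unfolding openin_prod_topology_alt by meson
  have "W +>\<^bsub>V\<^esub> a \<noteq> W +>\<^bsub>V\<^esub> b" if ab: "a \<in> A" "b \<in> B" for a b
  proof -
    have "(a, b) \<in> {p \<in> topspace (prod_topology (lie_top V) (lie_top V)).
        fst p \<ominus>\<^bsub>V\<^esub> snd p \<in> topspace (lie_top V) - W}"
      using AB(5) ab by (intro subsetD[OF AB(5)]) simp
    then show ?thesis
      by (simp add: topspace_lie_top coset_eq_iff)
  qed
  then have "disjnt ((\<lambda>v. W +>\<^bsub>V\<^esub> v) ` A) ((\<lambda>v. W +>\<^bsub>V\<^esub> v) ` B)"
    by (auto simp: disjnt_iff)
  moreover have "openin (lie_top (quot V W)) ((\<lambda>v. W +>\<^bsub>V\<^esub> v) ` A)"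
    "openin (lie_top (quot V W)) ((\<lambda>v. W +>\<^bsub>V\<^esub> v) ` B)"
    using AB(1,2) coset_open_map unfolding open_map_def by auto
  moreover have "X \<in> (\<lambda>v. W +>\<^bsub>V\<^esub> v) ` A" "Y \<in> (\<lambda>v. W +>\<^bsub>V\<^esub> v) ` B"
    using AB(3,4) u(2) v(2) by auto
  ultimately show "\<exists>U U'. openin (lie_top (quot V W)) U \<and> openin (lie_top (quot V W)) U' \<and>
      X \<in> U \<and> Y \<in> U' \<and> disjnt U U'"
    by (intro exI conjI)
qed

lemma quot_topological_vector_space:
  assumes "closedin (lie_top V) W"
  shows "topological_vector_space K (quot V W)"
proof (intro topological_vector_space.intro topological_vector_space_axioms.intro
    quot_module topological_field_axioms topspace_quot quot_Hausdorff[OF assms])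
  show "continuous_map (prod_topology (lie_top (quot V W)) (lie_top (quot V W))) (lie_top (quot V W))
      (\<lambda>(X, Y). X \<oplus>\<^bsub>quot V W\<^esub> Y)"
  proof (rule continuous_map_open_quotient)
    show "open_quotient_map (prod_topology (lie_top V) (lie_top V))
        (prod_topology (lie_top (quot V W)) (lie_top (quot V W)))
        (map_prod (\<lambda>v. W +>\<^bsub>V\<^esub> v) (\<lambda>v. W +>\<^bsub>V\<^esub> v))"
      by (intro open_quotient_map_prod coset_open_quotient_map)
    show "continuous_map (prod_topology (lie_top V) (lie_top V)) (lie_top (quot V W))
        (\<lambda>p. case map_prod (\<lambda>v. W +>\<^bsub>V\<^esub> v) (\<lambda>v. W +>\<^bsub>V\<^esub> v) p of (X, Y) \<Rightarrow> X \<oplus>\<^bsub>quot V W\<^esub> Y)"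
      by (rule continuous_map_eq[OF continuous_map_compose[OF continuous_vadd coset_continuous]])
        (auto simp: topspace_lie_top quot_add)
  qed
  show "continuous_map (prod_topology (ring_top K) (lie_top (quot V W))) (lie_top (quot V W))
      (\<lambda>(c, X). c \<odot>\<^bsub>quot V W\<^esub> X)"
  proof (rule continuous_map_open_quotient)
    show "open_quotient_map (prod_topology (ring_top K) (lie_top V))
        (prod_topology (ring_top K) (lie_top (quot V W))) (map_prod (\<lambda>c. c) (\<lambda>v. W +>\<^bsub>V\<^esub> v))"
      by (intro open_quotient_map_prod coset_open_quotient_map open_quotient_map_ident)
    show "continuous_map (prod_topology (ring_top K) (lie_top V)) (lie_top (quot V W))
        (\<lambda>p. case map_prod (\<lambda>c. c) (\<lambda>v. W +>\<^bsub>V\<^esub> v) p of (c, X) \<Rightarrow> c \<odot>\<^bsub>quot V W\<^esub> X)"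
      by (rule continuous_map_eq[OF continuous_map_compose[OF continuous_smult coset_continuous]])
        (auto simp: topspace_lie_top topspace_ring_top quot_smult)
  qed
qed

end

locale tla_quotient = tla K L + tvs_quotient K L I
  for K :: "('k, 'c) topological_ring_scheme" (structure) and L :: "('k, 'v) top_lie" (structure)
    and I :: "'v set" +
  assumes bracket_mem_right: "\<lbrakk>x \<in> carrier L; y \<in> I\<rbrakk> \<Longrightarrow> lie_bracket L x y \<in> I"
begin

lemma bracket_mem_left: "\<lbrakk>x \<in> I; y \<in> carrier L\<rbrakk> \<Longrightarrow> lie_bracket L x y \<in> I"
  by (metis subspace_mem(2) subspace_mem(3) bracket_antisym bracket_mem_right)

lemma quot_bracket:
  assumes u: "u \<in> carrier L" and v: "v \<in> carrier L"
  shows "lie_bracket (quot L I) (I +>\<^bsub>L\<^esub> u) (I +>\<^bsub>L\<^esub> v) = I +>\<^bsub>L\<^esub> lie_bracket L u v"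
proof -
  \<comment> \<open>The representatives are changed one at a time: by bilinearity each change alters
    the bracket by a bracket with one entry in \<open>I\<close>, hence by an element of
    \<open>I\<close>.\<close>
  have right: "I +>\<^bsub>L\<^esub> lie_bracket L a b = I +>\<^bsub>L\<^esub> lie_bracket L a v"
    if "a \<in> carrier L" "b \<in> carrier L" "b \<ominus>\<^bsub>L\<^esub> v \<in> I" for a b
    unfolding coset_eq_iff[OF bracket_closed[OF that(1,2)] bracket_closed[OF that(1) v]]
    using bracket_mem_right[OF that(1,3)] bracket_minus_right[OF that(1,2) v] by (simp only:)
  have left: "I +>\<^bsub>L\<^esub> lie_bracket L a v = I +>\<^bsub>L\<^esub> lie_bracket L u v"
    if "a \<in> carrier L" "a \<ominus>\<^bsub>L\<^esub> u \<in> I" for a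
    unfolding coset_eq_iff[OF bracket_closed[OF that(1) v] bracket_closed[OF u v]]
    using bracket_mem_left[OF that(2) v] bracket_minus_left[OF that(1) u v] by (simp only:)
  have "lie_bracket (quot L I) (I +>\<^bsub>L\<^esub> u) (I +>\<^bsub>L\<^esub> v) =
      (\<Union>a\<in>I +>\<^bsub>L\<^esub> u. \<Union>b\<in>I +>\<^bsub>L\<^esub> v. I +>\<^bsub>L\<^esub> lie_bracket L a b)"
    by (simp add: quot_def)
  also have "\<dots> = (\<Union>a\<in>I +>\<^bsub>L\<^esub> u. I +>\<^bsub>L\<^esub> lie_bracket L a v)"
    by (rule SUP_cong[OF refl], rule UN_coset[OF v], rule right[OF coset_subset[OF u]])
  also have "\<dots> = I +>\<^bsub>L\<^esub> lie_bracket L u v"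
    using left by (rule UN_coset[OF u])
  finally show ?thesis .
qed

lemma coset_lie_hom: "lie_hom K L (quot L I) (\<lambda>v. I +>\<^bsub>L\<^esub> v)"
  by (simp add: lie_hom_def coset_linear quot_bracket)

lemma quot_topological_lie_algebra:
  assumes "closedin (lie_top L) I"
  shows "topological_lie_algebra K (quot L I)"
proof (intro topological_lie_algebra.intro topological_lie_algebra_axioms.intro
    quot_topological_vector_space[OF assms])
  show "lie_algebra K (quot L I)"
    using lie_algebra_axioms coset_lie_hom carrier_quot[symmetric]
    by (rule lie_algebra_image) (simp add: coset_zero quot_simps)
  show "continuous_map (prod_topology (lie_top (quot L I)) (lie_top (quot L I))) (lie_top (quot L I))
      (\<lambda>(X, Y). lie_bracket (quot L I) X Y)"
  proof (rule continuous_map_open_quotient)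
    show "open_quotient_map (prod_topology (lie_top L) (lie_top L))
        (prod_topology (lie_top (quot L I)) (lie_top (quot L I)))
        (map_prod (\<lambda>v. I +>\<^bsub>L\<^esub> v) (\<lambda>v. I +>\<^bsub>L\<^esub> v))"
      by (intro open_quotient_map_prod coset_open_quotient_map)
    show "continuous_map (prod_topology (lie_top L) (lie_top L)) (lie_top (quot L I))
        (\<lambda>p. case map_prod (\<lambda>v. I +>\<^bsub>L\<^esub> v) (\<lambda>v. I +>\<^bsub>L\<^esub> v) p of (X, Y) \<Rightarrow> lie_bracket (quot L I) X Y)"
      by (rule continuous_map_eq[OF continuous_map_compose[OF continuous_bracket coset_continuous]])
        (auto simp: topspace_lie_top quot_bracket)
  qed
qed

end


section \<open>Topologically split kernels\<close>

locale tvs_hom = E: topological_vector_space K E + G: topological_vector_space K G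
  for K :: "('k, 'c) topological_ring_scheme" (structure)
    and E :: "('k, 'e) top_lie" and G :: "('k, 'g) top_lie" +
  fixes q :: "'e \<Rightarrow> 'g"
  assumes continuous_linear: "continuous_linear_map K E G q"
begin

lemma linear: "linear_map K E G q" and continuous: "continuous_map (lie_top E) (lie_top G) q"
  using continuous_linear by (simp_all add: continuous_linear_map_def)

lemmas q_closed = linear_mapD(1)[OF linear]
  and q_add = linear_mapD(2)[OF linear]
  and q_smult = linear_mapD(3)[OF linear]
  and q_zero = linear_map_zero[OF E.M.abelian_group_axioms G.M.abelian_group_axioms linear]
  and q_uminus = linear_map_uminus[OF E.M.abelian_group_axioms G.M.abelian_group_axioms linear]
  and q_minus = linear_map_minus[OF E.M.abelian_group_axioms G.M.abelian_group_axioms linear]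

abbreviation W :: "'e set" where "W \<equiv> a_kernel E G q"

lemma mem_kernel: "v \<in> W \<longleftrightarrow> v \<in> carrier E \<and> q v = \<zero>\<^bsub>G\<^esub>"
  by (simp add: a_kernel_def')

lemma submodule_kernel: "submodule W K E"
  by (rule E.submoduleI) (auto simp: mem_kernel q_zero q_add q_smult q_uminus)

lemma closedin_kernel: "closedin (lie_top E) W"
proof -
  have "closedin (lie_top G) {\<zero>\<^bsub>G\<^esub>}"
    using G.Hausdorff by (intro closedin_Hausdorff_singleton) (simp_all add: G.topspace_lie_top)
  from closedin_continuous_map_preimage[OF continuous this] show ?thesis
    by (simp add: a_kernel_def' E.topspace_lie_top)
qed

lemma kernel_quotient: "tvs_quotient K E W"
  by (intro tvs_quotient.intro tvs_quotient_axioms.intro submodule_kernel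
    E.topological_vector_space_axioms)

interpretation Q: tvs_quotient K E W
  by (rule kernel_quotient)

text \<open>The injection of the first isomorphism theorem. The map \<open>q\<close> is constant on
  each coset of its kernel, so the image of a coset is a singleton and \<open>the_elem\<close> picks
  its value.\<close>

abbreviation induced :: "'e set \<Rightarrow> 'g"
  where "induced X \<equiv> the_elem (q ` X)"

lemma coset_eq_iff_image:
  assumes "u \<in> carrier E" "v \<in> carrier E"
  shows "W +>\<^bsub>E\<^esub> u = W +>\<^bsub>E\<^esub> v \<longleftrightarrow> q u = q v"
  unfolding Q.coset_eq_iff[OF assms]
  using assms by (simp add: mem_kernel q_minus q_closed G.M.minus_eq_zero_iff)

lemma induced_coset:
  assumes "v \<in> carrier E"
  shows "induced (W +>\<^bsub>E\<^esub> v) = q v"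
proof -
  have "(\<Union>u\<in>W +>\<^bsub>E\<^esub> v. {q u}) = {q v}"
  proof (rule Q.UN_coset[OF assms])
    fix u assume "u \<in> carrier E" "u \<ominus>\<^bsub>E\<^esub> v \<in> W"
    then show "{q u} = {q v}"
      using assms Q.coset_eq_iff[of u v] coset_eq_iff_image[of u v] by simp
  qed
  then have "q ` (W +>\<^bsub>E\<^esub> v) = {q v}"
    by (simp add: UNION_singleton_eq_range)
  then show ?thesis by simp
qed

lemma induced_linear: "linear_map K (quot E W) G induced"
proof (rule linear_mapI)
  fix X assume X: "X \<in> carrier (quot E W)"
  then obtain u where u: "u \<in> carrier E" "X = W +>\<^bsub>E\<^esub> u" by (rule Q.quot_cases)
  show "induced X \<in> carrier G"
    using u by (simp add: induced_coset q_closed)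
  {
    fix Y assume "Y \<in> carrier (quot E W)"
    then obtain v where v: "v \<in> carrier E" "Y = W +>\<^bsub>E\<^esub> v" by (rule Q.quot_cases)
    show "induced (X \<oplus>\<^bsub>quot E W\<^esub> Y) = induced X \<oplus>\<^bsub>G\<^esub> induced Y"
      using u v by (simp add: Q.quot_add induced_coset q_add)
  }
  fix c assume "c \<in> carrier K"
  then show "induced (c \<odot>\<^bsub>quot E W\<^esub> X) = c \<odot>\<^bsub>G\<^esub> induced X"
    using u by (simp add: Q.quot_smult induced_coset q_smult)
qed

lemma induced_continuous: "continuous_map (lie_top (quot E W)) (lie_top G) induced"
  by (rule continuous_map_open_quotient[OF Q.coset_open_quotient_map])
    (rule continuous_map_eq[OF continuous], simp add: E.topspace_lie_top induced_coset)

lemma induced_inj: "inj_on induced (carrier (quot E W))"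
proof (rule inj_onI)
  fix X Y assume X: "X \<in> carrier (quot E W)" and Y: "Y \<in> carrier (quot E W)"
    and eq: "induced X = induced Y"
  obtain u where u: "u \<in> carrier E" "X = W +>\<^bsub>E\<^esub> u" using X by (rule Q.quot_cases)
  obtain v where v: "v \<in> carrier E" "Y = W +>\<^bsub>E\<^esub> v" using Y by (rule Q.quot_cases)
  show "X = Y"
    using eq u v by (simp add: induced_coset coset_eq_iff_image)
qed

text \<open>The map \<open>q\<close> factors as \<open>induced\<close> after the coset map, so
  \<open>induced\<close> inherits being a quotient map; an injective quotient map is a
  homeomorphism.\<close>

lemma induced_homeomorphic:
  assumes "quotient_map (lie_top E) (lie_top G) q"
  shows "homeomorphic_map (lie_top (quot E W)) (lie_top G) induced"
proof -
  have "quotient_map (lie_top E) (lie_top G) (induced \<circ> (\<lambda>v. W +>\<^bsub>E\<^esub> v))"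
    using assms by (rule quotient_map_eq) (simp add: E.topspace_lie_top induced_coset)
  then have "quotient_map (lie_top (quot E W)) (lie_top G) induced"
    by (rule quotient_map_from_composition[OF Q.coset_continuous induced_continuous])
  then show ?thesis
    by (simp add: homeomorphic_map_def Q.topspace_quot induced_inj)
qed

text \<open>A continuous linear section \<open>s\<close> of \<open>q\<close> splits \<open>E\<close> by means of the projection
  \<open>v \<mapsto> v - s (q v)\<close> onto the kernel.\<close>

lemma topologically_split_kernel:
  assumes s: "continuous_linear_map K G E s" and qs: "\<And>y. y \<in> carrier G \<Longrightarrow> q (s y) = y"
  shows "topologically_split K E W"
  unfolding topologically_split_def
proof (intro conjI exI submodule_kernel closedin_kernel ballI)
  have s_lin: "linear_map K G E s" and s_cont: "continuous_map (lie_top G) (lie_top E) s"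
    using s by (simp_all add: continuous_linear_map_def)
  \<comment> \<open>The section \<open>s\<close> lives on \<open>G\<close>, while splitting asks for
    a section on \<open>quot E W\<close>; \<open>induced\<close> carries one space to the
    other.\<close>
  let ?\<sigma> = "\<lambda>X. s (induced X)"
  have lin: "linear_map K (quot E W) E ?\<sigma>"
    using induced_linear s_lin by (rule linear_map_compose)
  have cont: "continuous_map (lie_top (quot E W)) (lie_top E) ?\<sigma>"
    using continuous_map_compose[OF induced_continuous s_cont] by (simp add: o_def)
  show "continuous_linear_map K (quot E W) E ?\<sigma>"
    using lin cont by (simp add: continuous_linear_map_def)
  note sc = linear_mapD(1)[OF s_lin]
  show "W +>\<^bsub>E\<^esub> ?\<sigma> X = X" if "X \<in> carrier (quot E W)" for X
  proof -
    obtain v where "v \<in> carrier E" "X = W +>\<^bsub>E\<^esub> v" using \<open>X \<in> carrier (quot E W)\<close> by (rule Q.quot_cases)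
    then show ?thesis
      by (simp add: induced_coset coset_eq_iff_image sc q_closed qs)
  qed
  let ?P = "direct_prod (sub E W) (quot E W)"
  let ?F = "\<lambda>(w, X). w \<oplus>\<^bsub>E\<^esub> ?\<sigma> X"
  have carrier_P: "carrier ?P = W \<times> carrier (quot E W)"
    and top_P: "lie_top ?P = prod_topology (subtopology (lie_top E) W) (lie_top (quot E W))"
    by (simp_all add: direct_prod_def sub_def)
  show "tvs_iso K ?P E ?F"
    unfolding tvs_iso_def
  proof
    show "linear_map K ?P E ?F"
    proof (rule linear_mapI)
      fix p assume "p \<in> carrier ?P"
      then obtain w X where p: "p = (w, X)" "w \<in> carrier E" "w \<in> W" "X \<in> carrier (quot E W)"
        by (auto simp: carrier_P mem_kernel)
      note X = linear_mapD(1)[OF lin p(4)]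
      show "?F p \<in> carrier E"
        using p X by simp
      {
        fix p' assume "p' \<in> carrier ?P"
        then obtain w' X' where p': "p' = (w', X')" "w' \<in> carrier E" "X' \<in> carrier (quot E W)"
          by (auto simp: carrier_P mem_kernel)
        note X' = linear_mapD(1)[OF lin p'(3)]
        show "?F (p \<oplus>\<^bsub>?P\<^esub> p') = ?F p \<oplus>\<^bsub>E\<^esub> ?F p'"
          using p p' X X' linear_mapD(2)[OF lin p(4) p'(3)]
          by (simp add: direct_prod_def sub_def E.M.a_ac)
      }
      fix c assume "c \<in> carrier K"
      then show "?F (c \<odot>\<^bsub>?P\<^esub> p) = c \<odot>\<^bsub>E\<^esub> ?F p"
        using p X linear_mapD(3)[OF lin _ p(4)]
        by (simp add: direct_prod_def sub_def E.smult_r_distr)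
    qed
    let ?G = "\<lambda>v. (v \<ominus>\<^bsub>E\<^esub> s (q v), W +>\<^bsub>E\<^esub> v)"
    have kernel_part: "v \<ominus>\<^bsub>E\<^esub> s (q v) \<in> W" if "v \<in> carrier E" for v
      using that G.M.minus_eq_zero_iff[of "q v" "q v"]
      by (simp add: mem_kernel q_minus sc q_closed qs)
    have "homeomorphic_maps (lie_top ?P) (lie_top E) ?F ?G"
      unfolding homeomorphic_maps_def top_P
    proof (intro conjI ballI)
      have "continuous_map (prod_topology (subtopology (lie_top E) W) (lie_top (quot E W)))
          (lie_top E) (\<lambda>p. fst p \<oplus>\<^bsub>E\<^esub> ?\<sigma> (snd p))"
      proof (rule E.continuous_map_vadd)
        show "continuous_map (prod_topology (subtopology (lie_top E) W) (lie_top (quot E W)))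
            (lie_top E) fst"
          using continuous_map_fst continuous_map_in_subtopology by blast
        show "continuous_map (prod_topology (subtopology (lie_top E) W) (lie_top (quot E W)))
            (lie_top E) (\<lambda>p. ?\<sigma> (snd p))"
          using continuous_map_compose[OF continuous_map_snd cont] by (simp add: o_def)
      qed
      then show "continuous_map (prod_topology (subtopology (lie_top E) W) (lie_top (quot E W)))
          (lie_top E) ?F"
        by (simp add: case_prod_unfold)
      have "continuous_map (lie_top E) (lie_top E) (\<lambda>v. v \<ominus>\<^bsub>E\<^esub> s (q v))"
        using continuous_map_compose[OF continuous s_cont]
        by (intro E.continuous_map_vminus) (simp_all add: o_def)
      then show "continuous_map (lie_top E)
          (prod_topology (subtopology (lie_top E) W) (lie_top (quot E W))) ?G"
        using kernel_part
        by (intro continuous_map_pairedI Q.coset_continuous)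
          (auto simp: continuous_map_in_subtopology E.topspace_lie_top)
    next
      fix p assume "p \<in> topspace (prod_topology (subtopology (lie_top E) W) (lie_top (quot E W)))"
      then have "fst p \<in> W" "snd p \<in> carrier (quot E W)"
        by (auto simp: Q.topspace_quot)
      then obtain w v where p: "p = (w, W +>\<^bsub>E\<^esub> v)" "w \<in> carrier E" "q w = \<zero>\<^bsub>G\<^esub>" "v \<in> carrier E"
        by (metis Q.quot_cases mem_kernel prod.collapse)
      have "w \<oplus>\<^bsub>E\<^esub> s (q v) \<ominus>\<^bsub>E\<^esub> s (q v) = w"
        using p(2) sc[OF q_closed[OF p(4)]] by algebra
      \<comment> \<open>Since \<open>q\<close> kills \<open>w\<close> and undoes \<open>s\<close>,
        it maps \<open>?F p\<close> to \<open>q v\<close>. This recovers both \<open>w\<close> as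
        the kernel part and the coset of \<open>v\<close>.\<close>
      then show "?G (?F p) = p"
        using p by (simp add: induced_coset coset_eq_iff_image q_add q_closed sc qs)
    next
      fix v assume "v \<in> topspace (lie_top E)"
      then have v: "v \<in> carrier E" by (simp add: E.topspace_lie_top)
      show "?F (?G v) = v"
        using v sc[OF q_closed[OF v]] unfolding prod.case induced_coset[OF v] by algebra
    qed
    then show "homeomorphic_map (lie_top ?P) (lie_top E) ?F"
      by (rule homeomorphic_maps_imp_map)
  qed
qed

end


section \<open>Direct products\<close>

lemma direct_prod_simps:
  "carrier (direct_prod V W) = carrier V \<times> carrier W"
  "\<zero>\<^bsub>direct_prod V W\<^esub> = (\<zero>\<^bsub>V\<^esub>, \<zero>\<^bsub>W\<^esub>)"
  "(v, w) \<oplus>\<^bsub>direct_prod V W\<^esub> (v', w') = (v \<oplus>\<^bsub>V\<^esub> v', w \<oplus>\<^bsub>W\<^esub> w')"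
  "c \<odot>\<^bsub>direct_prod V W\<^esub> (v, w) = (c \<odot>\<^bsub>V\<^esub> v, c \<odot>\<^bsub>W\<^esub> w)"
  "lie_top (direct_prod V W) = prod_topology (lie_top V) (lie_top W)"
  by (simp_all add: direct_prod_def)

lemma direct_prod_module:
  assumes "module K V" "module K W"
  shows "module K (direct_prod V W)"
proof -
  interpret V: module K V by fact
  interpret W: module K W by fact
  show ?thesis
  proof (intro moduleI V.is_cring abelian_groupI)
    fix p assume "p \<in> carrier (direct_prod V W)"
    then obtain v w where p: "p = (v, w)" "v \<in> carrier V" "w \<in> carrier W"
      by (auto simp: direct_prod_simps)
    then show "\<exists>p'\<in>carrier (direct_prod V W). p' \<oplus>\<^bsub>direct_prod V W\<^esub> p = \<zero>\<^bsub>direct_prod V W\<^esub>"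
      by (intro bexI[of _ "(\<ominus>\<^bsub>V\<^esub> v, \<ominus>\<^bsub>W\<^esub> w)"])
        (simp_all add: direct_prod_simps V.M.l_neg W.M.l_neg)
  qed (auto simp: direct_prod_simps V.M.a_ac W.M.a_ac V.smult_l_distr W.smult_l_distr
      V.smult_r_distr W.smult_r_distr V.smult_assoc1 W.smult_assoc1)
qed

lemma direct_prod_topological_vector_space:
  assumes "topological_vector_space K V" "topological_vector_space K W"
  shows "topological_vector_space K (direct_prod V W)"
proof -
  interpret V: topological_vector_space K V by fact
  interpret W: topological_vector_space K W by fact
  let ?T = "lie_top (direct_prod V W)"
  have fst: "continuous_map ?T (lie_top V) fst" and snd: "continuous_map ?T (lie_top W) snd"
    by (simp_all add: direct_prod_simps continuous_map_fst continuous_map_snd)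
  show ?thesis
  proof (intro topological_vector_space.intro topological_vector_space_axioms.intro
      direct_prod_module V.module_axioms W.module_axioms V.topological_field_axioms)
    show "topspace ?T = carrier (direct_prod V W)"
      by (simp add: direct_prod_simps V.topspace_lie_top W.topspace_lie_top)
    show "Hausdorff_space ?T"
      by (simp add: direct_prod_simps Hausdorff_space_prod_topology V.Hausdorff W.Hausdorff)
    \<comment> \<open>Only the target topology gets unfolded into a product, so that continuity
      splits into components; the source stays folded to match the composed projections.\<close>
    have "continuous_map (prod_topology ?T ?T) ?T
        (\<lambda>p. (fst (fst p) \<oplus>\<^bsub>V\<^esub> fst (snd p), snd (fst p) \<oplus>\<^bsub>W\<^esub> snd (snd p)))"
      unfolding direct_prod_simps(5)[of V W, symmetric] continuous_map_paired
      using continuous_map_compose[OF continuous_map_fst fst]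
        continuous_map_compose[OF continuous_map_snd fst]
        continuous_map_compose[OF continuous_map_fst snd]
        continuous_map_compose[OF continuous_map_snd snd]
      by (subst (3) direct_prod_simps(5))
        (intro continuous_map_pairedI V.continuous_map_vadd W.continuous_map_vadd; simp add: o_def)
    then show "continuous_map (prod_topology ?T ?T) ?T (\<lambda>(p, p'). p \<oplus>\<^bsub>direct_prod V W\<^esub> p')"
      by (simp add: direct_prod_def case_prod_unfold)
    have "continuous_map (prod_topology (ring_top K) ?T) ?T
        (\<lambda>p. (fst p \<odot>\<^bsub>V\<^esub> fst (snd p), fst p \<odot>\<^bsub>W\<^esub> snd (snd p)))"
      using continuous_map_compose[OF continuous_map_snd fst]
        continuous_map_compose[OF continuous_map_snd snd]
      by (subst (2) direct_prod_simps(5))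
        (intro continuous_map_pairedI V.continuous_map_smult W.continuous_map_smult
          continuous_map_fst; simp add: o_def)
    then show "continuous_map (prod_topology (ring_top K) ?T) ?T (\<lambda>(c, p). c \<odot>\<^bsub>direct_prod V W\<^esub> p)"
      by (simp add: direct_prod_def case_prod_unfold)
  qed
qed

text \<open>\<open>gS\<close> is a direct product whose bracket has been replaced. The vector space
  structure ignores the bracket, so it is carried over by the identity map.\<close>

lemma topological_vector_space_bracket_update:
  assumes "topological_vector_space K V"
  shows "topological_vector_space K (V\<lparr>lie_bracket := b\<rparr>)"
proof -
  interpret topological_vector_space K V by fact
  have "module K (V\<lparr>lie_bracket := b\<rparr>)"
    by (rule module_image[OF module_axioms, where f = "\<lambda>x. x"]) (simp_all add: linear_map_def)
  then show ?thesis
    using topological_field_axioms topspace_lie_top Hausdorff continuous_vadd continuous_smult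
    by (simp add: topological_vector_space_def topological_vector_space_axioms_def)
qed


section \<open>The center\<close>

context tla
begin

lemma mem_center_iff: "z \<in> center L \<longleftrightarrow> z \<in> carrier L \<and> ad L z = \<zero>\<^bsub>der K L\<^esub>"
  by (simp add: center_eq_ker_ad a_kernel_def')

text \<open>The center is the intersection, over all x in the nonempty carrier, of the zero sets of
  the continuous maps sending z to [z, x], and {0} is closed in a Hausdorff space. This is what
  makes \<open>n_ad\<close> Hausdorff.\<close>

lemma closedin_center: "closedin (lie_top L) (center L)"
proof -
  have "closedin (lie_top L) (\<Inter>x\<in>carrier L. {z \<in> topspace (lie_top L). lie_bracket L z x \<in> {\<zero>\<^bsub>L\<^esub>}})"
  proof (rule closedin_INT)
    show "carrier L \<noteq> {}"
      using M.zero_closed by blast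
    fix x assume "x \<in> carrier L"
    then have "continuous_map (lie_top L) (lie_top L) (\<lambda>z. lie_bracket L z x)"
      by (intro continuous_map_bracket) (simp_all add: topspace_lie_top)
    moreover have "closedin (lie_top L) {\<zero>\<^bsub>L\<^esub>}"
      using Hausdorff by (intro closedin_Hausdorff_singleton) (simp_all add: topspace_lie_top)
    ultimately show "closedin (lie_top L) {z \<in> topspace (lie_top L). lie_bracket L z x \<in> {\<zero>\<^bsub>L\<^esub>}}"
      by (rule closedin_continuous_map_preimage)
  qed
  moreover have "(\<Inter>x\<in>carrier L. {z \<in> topspace (lie_top L). lie_bracket L z x \<in> {\<zero>\<^bsub>L\<^esub>}}) = center L"
    unfolding center_def topspace_lie_top using M.zero_closed by auto
  ultimately show ?thesis by simp
qed

lemma center_quotient: "tla_quotient K L (center L)"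
proof (intro tla_quotient.intro tla_quotient_axioms.intro tvs_quotient.intro
    tvs_quotient_axioms.intro tla_axioms topological_vector_space_axioms)
  show "submodule (center L) K L"
    by (rule submoduleI) (auto simp: center_def bracket_zero_left bracket_add_left bracket_smult_left
      linear_map_uminus[OF M.abelian_group_axioms M.abelian_group_axioms bracket_linear_left])
  fix x z assume "x \<in> carrier L" "z \<in> center L"
  then show "lie_bracket L x z \<in> center L"
    using bracket_antisym[of x z] by (simp add: center_def bracket_zero_left M.abelian_group_simprules)
qed

interpretation Z: tla_quotient K L "center L"
  by (rule center_quotient)

text \<open>The algebraic content of identifying the quotient by the center with the inner
  derivations: the center is the kernel of the linear map \<open>ad\<close>.\<close>

lemma ad_class_eq_iff:
  assumes "u \<in> carrier L" "v \<in> carrier L"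
  shows "ad_class L u = ad_class L v \<longleftrightarrow> ad L u = ad L v"
  unfolding Z.coset_eq_iff[OF assms] mem_center_iff
  using assms abelian_group.minus_eq_zero_iff[OF der_abelian_group ad_closed ad_closed]
  by (simp add: ad_minus)

text \<open>Justifies \<open>the_elem\<close> in \<open>rho_S\<close>.\<close>

lemma ad_image_ad_class:
  assumes "u \<in> carrier L"
  shows "ad L ` ad_class L u = {ad L u}"
proof -
  have "(\<Union>v\<in>ad_class L u. {ad L v}) = {ad L u}"
  proof (rule Z.UN_coset[OF assms])
    fix v assume "v \<in> carrier L" "v \<ominus>\<^bsub>L\<^esub> u \<in> center L"
    then show "{ad L v} = {ad L u}"
      using assms Z.coset_eq_iff[of v u] ad_class_eq_iff[of v u] by simp
  qed
  then show ?thesis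
    by (simp add: UNION_singleton_eq_range)
qed

end


section \<open>The Lie algebra of a continuous outer action\<close>

text \<open>\<open>continuous_outer_action\<close> asserts only that some \<omega> exists. A
  particular one is a parameter because \<open>gS\<close> is formed with it, and so that two choices
  can be compared by interpreting the locale twice.\<close>

locale outer_action = \<nn>: tla K \<nn> + \<gg>: tla K \<gg>
  for K :: "('k, 'c) topological_ring_scheme" (structure)
    and \<gg> :: "('k, 'g) top_lie" and \<nn> :: "('k, 'n) top_lie" +
  fixes S :: "'g \<Rightarrow> 'n \<Rightarrow> 'n" and \<omega> :: "'g \<Rightarrow> 'g \<Rightarrow> 'n"
  assumes action: "continuous_outer_action K \<gg> \<nn> S"
    and cochain: "\<omega> \<in> C2 K \<gg> \<nn>"
    and curvature: "curvature_is_ad K \<gg> \<nn> S \<omega>"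
begin

interpretation der: lie_algebra K "der K \<nn>"
  by (rule \<nn>.der_lie_algebra)

interpretation Z: tla_quotient K \<nn> "center \<nn>"
  by (rule \<nn>.center_quotient)

lemma n_ad_topological_lie_algebra: "topological_lie_algebra K (n_ad \<nn>)"
  by (rule Z.quot_topological_lie_algebra[OF \<nn>.closedin_center])

interpretation n_ad: topological_lie_algebra K "n_ad \<nn>"
  by (rule n_ad_topological_lie_algebra)

lemma S_linear: "linear_map K \<gg> (der K \<nn>) S"
  using action by (simp add: continuous_outer_action_def)

lemmas S_der = linear_mapD(1)[OF S_linear]
  and S_zero = linear_map_zero[OF \<gg>.M.abelian_group_axioms der.M.abelian_group_axioms S_linear]

lemma S_closed: "\<lbrakk>x \<in> carrier \<gg>; u \<in> carrier \<nn>\<rbrakk> \<Longrightarrow> S x u \<in> carrier \<nn>"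
  by (rule \<nn>.derD(3)[OF S_der])

lemma \<omega>_closed: "\<lbrakk>x \<in> carrier \<gg>; y \<in> carrier \<gg>\<rbrakk> \<Longrightarrow> \<omega> x y \<in> carrier \<nn>"
  using cochain by (simp add: C2_def linear_map_def Pi_def)

lemma \<omega>_zero_right: "x \<in> carrier \<gg> \<Longrightarrow> \<omega> x \<zero>\<^bsub>\<gg>\<^esub> = \<zero>\<^bsub>\<nn>\<^esub>"
  using cochain linear_map_zero[OF \<gg>.M.abelian_group_axioms \<nn>.M.abelian_group_axioms, of K "\<omega> x"]
  by (simp add: C2_def)

lemma S_bracket:
  assumes "x \<in> carrier \<gg>" "y \<in> carrier \<gg>"
  shows "lie_bracket (der K \<nn>) (S x) (S y) =
    ad \<nn> (\<omega> x y) \<oplus>\<^bsub>der K \<nn>\<^esub> S (lie_bracket \<gg> x y)"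
proof -
  have "a = (a \<ominus>\<^bsub>der K \<nn>\<^esub> b) \<oplus>\<^bsub>der K \<nn>\<^esub> b" if "a \<in> carrier (der K \<nn>)" "b \<in> carrier (der K \<nn>)" for a b
    using that by algebra
  moreover have "lie_bracket (der K \<nn>) (S x) (S y) \<ominus>\<^bsub>der K \<nn>\<^esub> S (lie_bracket \<gg> x y) = ad \<nn> (\<omega> x y)"
    using curvature assms by (simp add: curvature_is_ad_def R_S_def)
  ultimately show ?thesis
    using assms by (metis S_der der.bracket_closed \<gg>.bracket_closed)
qed

section \<open>The bracket and the action, computed on representatives\<close>

abbreviation T :: "'n \<Rightarrow> 'g \<Rightarrow> 'n \<Rightarrow> 'n"
  where "T u x \<equiv> ad \<nn> u \<oplus>\<^bsub>der K \<nn>\<^esub> S x"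

text \<open>A representative in \<nn> of the first component of the bracket of \<open>gS\<close>,
  just as \<open>T u x\<close> is the value of \<open>rho_S\<close> at the class of (u, x).\<close>

abbreviation B :: "'n \<Rightarrow> 'g \<Rightarrow> 'n \<Rightarrow> 'g \<Rightarrow> 'n"
  where "B u x u' x' \<equiv>
    lie_bracket \<nn> u u' \<oplus>\<^bsub>\<nn>\<^esub> S x u' \<ominus>\<^bsub>\<nn>\<^esub> S x' u \<oplus>\<^bsub>\<nn>\<^esub> \<omega> x x'"

lemma T_closed: "\<lbrakk>u \<in> carrier \<nn>; x \<in> carrier \<gg>\<rbrakk> \<Longrightarrow> T u x \<in> carrier (der K \<nn>)"
  by (intro \<nn>.der_add_closed \<nn>.ad_closed S_der)

lemma T_apply: "\<lbrakk>x \<in> carrier \<gg>; v \<in> carrier \<nn>\<rbrakk> \<Longrightarrow> T u x v = lie_bracket \<nn> u v \<oplus>\<^bsub>\<nn>\<^esub> S x v"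
  by (simp add: \<nn>.der_apply \<nn>.ad_apply)

lemma B_closed:
  "\<lbrakk>u \<in> carrier \<nn>; x \<in> carrier \<gg>; u' \<in> carrier \<nn>; x' \<in> carrier \<gg>\<rbrakk> \<Longrightarrow> B u x u' x' \<in> carrier \<nn>"
  by (intro \<nn>.M.a_closed \<nn>.M.minus_closed \<nn>.bracket_closed S_closed \<omega>_closed)

text \<open>Expanding the commutator shows where the summands of \<open>B\<close> come from: the two
  inner parts give ad [u, u'], the mixed brackets give ad (S x u') and -ad (S x' u) because inner
  derivations form an ideal, and the bracket of S x with S x' contributes ad (\<omega> x x') besides
  the remaining S [x, x'].\<close>

lemma T_bracket:
  assumes u: "u \<in> carrier \<nn>" and x: "x \<in> carrier \<gg>" and u': "u' \<in> carrier \<nn>" and x': "x' \<in> carrier \<gg>"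
  shows "lie_bracket (der K \<nn>) (T u x) (T u' x') = T (B u x u' x') (lie_bracket \<gg> x x')"
proof -
  note ad = \<nn>.ad_closed[OF u] \<nn>.ad_closed[OF u'] and S = S_der[OF x] S_der[OF x']
  have 1: "lie_bracket (der K \<nn>) (ad \<nn> u) (S x') = \<ominus>\<^bsub>der K \<nn>\<^esub> ad \<nn> (S x' u)"
    using der.bracket_antisym[OF ad(1) S(2)] \<nn>.der_bracket_ad[OF S(2) u] by simp
  have "lie_bracket (der K \<nn>) (T u x) (T u' x') =
      (ad \<nn> (lie_bracket \<nn> u u') \<oplus>\<^bsub>der K \<nn>\<^esub> \<ominus>\<^bsub>der K \<nn>\<^esub> ad \<nn> (S x' u)) \<oplus>\<^bsub>der K \<nn>\<^esub>
      (ad \<nn> (S x u') \<oplus>\<^bsub>der K \<nn>\<^esub> (ad \<nn> (\<omega> x x') \<oplus>\<^bsub>der K \<nn>\<^esub> S (lie_bracket \<gg> x x')))"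
    unfolding der.bracket_add_left[OF ad(1) S(1) T_closed[OF u' x']]
      der.bracket_add_right[OF ad(1) ad(2) S(2)] der.bracket_add_right[OF S(1) ad(2) S(2)]
      \<nn>.ad_bracket[OF u u'] \<nn>.der_bracket_ad[OF S(1) u'] 1 S_bracket[OF x x'] ..
  also have "\<dots> = (ad \<nn> (lie_bracket \<nn> u u') \<oplus>\<^bsub>der K \<nn>\<^esub> ad \<nn> (S x u') \<ominus>\<^bsub>der K \<nn>\<^esub> ad \<nn> (S x' u)
      \<oplus>\<^bsub>der K \<nn>\<^esub> ad \<nn> (\<omega> x x')) \<oplus>\<^bsub>der K \<nn>\<^esub> S (lie_bracket \<gg> x x')"
  proof -
    have "(a \<oplus>\<^bsub>der K \<nn>\<^esub> \<ominus>\<^bsub>der K \<nn>\<^esub> b) \<oplus>\<^bsub>der K \<nn>\<^esub> (c \<oplus>\<^bsub>der K \<nn>\<^esub> (d \<oplus>\<^bsub>der K \<nn>\<^esub> e)) =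
        (a \<oplus>\<^bsub>der K \<nn>\<^esub> c \<ominus>\<^bsub>der K \<nn>\<^esub> b \<oplus>\<^bsub>der K \<nn>\<^esub> d) \<oplus>\<^bsub>der K \<nn>\<^esub> e"
      if "a \<in> carrier (der K \<nn>)" "b \<in> carrier (der K \<nn>)" "c \<in> carrier (der K \<nn>)"
        "d \<in> carrier (der K \<nn>)" "e \<in> carrier (der K \<nn>)" for a b c d e
      using that by algebra
    then show ?thesis
      using assms by (simp add: \<nn>.ad_closed S_der S_closed \<omega>_closed \<nn>.bracket_closed \<gg>.bracket_closed)
  qed
  also have "\<dots> = T (B u x u' x') (lie_bracket \<gg> x x')"
    using assms
    by (simp add: \<nn>.ad_add \<nn>.ad_minus S_closed \<omega>_closed \<nn>.bracket_closed)
  finally show ?thesis .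
qed

lemma T_eq_iff:
  assumes "u \<in> carrier \<nn>" "v \<in> carrier \<nn>" "x \<in> carrier \<gg>"
  shows "T u x = T v x \<longleftrightarrow> ad_class \<nn> u = ad_class \<nn> v"
  using assms by (simp add: \<nn>.ad_class_eq_iff \<nn>.ad_closed S_der)

section \<open>The Lie algebra \<open>gS\<close> and its maps to \<open>der K \<nn>\<close> and
  \<gg>\<close>

abbreviation G :: "('k, 'n set \<times> 'g) top_lie"
  where "G \<equiv> gS \<gg> \<nn> S \<omega>"

lemma gS_simps:
  "carrier G = carrier (n_ad \<nn>) \<times> carrier \<gg>"
  "\<zero>\<^bsub>G\<^esub> = (\<zero>\<^bsub>n_ad \<nn>\<^esub>, \<zero>\<^bsub>\<gg>\<^esub>)"
  "(X, x) \<oplus>\<^bsub>G\<^esub> (Y, y) = (X \<oplus>\<^bsub>n_ad \<nn>\<^esub> Y, x \<oplus>\<^bsub>\<gg>\<^esub> y)"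
  "c \<odot>\<^bsub>G\<^esub> (X, x) = (c \<odot>\<^bsub>n_ad \<nn>\<^esub> X, c \<odot>\<^bsub>\<gg>\<^esub> x)"
  "lie_top G = prod_topology (lie_top (n_ad \<nn>)) (lie_top \<gg>)"
  by (simp_all add: gS_def direct_prod_simps)

text \<open>Well-definedness needs no inspection of the single summands of \<open>B\<close>. By
  \<open>T_bracket\<close>, \<open>T\<close> applied to \<open>B u x u' x'\<close> depends only on
  \<open>T u x\<close> and \<open>T u' x'\<close>, hence only on the classes of u and u'; and for
  fixed second argument \<open>T\<close> determines the class.\<close>

lemma gS_bracket:
  assumes u: "u \<in> carrier \<nn>" and x: "x \<in> carrier \<gg>" and u': "u' \<in> carrier \<nn>" and x': "x' \<in> carrier \<gg>"
  shows "lie_bracket G (ad_class \<nn> u, x) (ad_class \<nn> u', x') =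
    (ad_class \<nn> (B u x u' x'), lie_bracket \<gg> x x')"
proof -
  have cong: "ad_class \<nn> (B a x b x') = ad_class \<nn> (B u x u' x')"
    if a: "a \<in> carrier \<nn>" "ad_class \<nn> a = ad_class \<nn> u"
      and b: "b \<in> carrier \<nn>" "ad_class \<nn> b = ad_class \<nn> u'" for a b
  proof -
    have "T (B a x b x') (lie_bracket \<gg> x x') = T (B u x u' x') (lie_bracket \<gg> x x')"
      using a b u x u' x' T_eq_iff[of a u x] T_eq_iff[of b u' x'] by (simp flip: T_bracket)
    then show ?thesis
      using a(1) b(1) u x u' x' by (simp add: T_eq_iff B_closed \<gg>.bracket_closed)
  qed
  have "(\<Union>a\<in>ad_class \<nn> u. \<Union>b\<in>ad_class \<nn> u'. ad_class \<nn> (B a x b x')) =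
      (\<Union>a\<in>ad_class \<nn> u. ad_class \<nn> (B a x u' x'))"
  proof (rule SUP_cong[OF refl], rule Z.UN_coset[OF u'])
    fix a b assume "a \<in> ad_class \<nn> u" and b: "b \<in> carrier \<nn>" "b \<ominus>\<^bsub>\<nn>\<^esub> u' \<in> center \<nn>"
    then have a: "a \<in> carrier \<nn>" "a \<ominus>\<^bsub>\<nn>\<^esub> u \<in> center \<nn>"
      using Z.coset_subset[OF u] Z.mem_coset_iff[OF _ u] by auto
    show "ad_class \<nn> (B a x b x') = ad_class \<nn> (B a x u' x')"
      using cong[OF a(1) _ b(1)] cong[OF a(1) _ u' refl] a b u u' by (simp add: Z.coset_eq_iff)
  qed
  also have "\<dots> = ad_class \<nn> (B u x u' x')"
  proof (rule Z.UN_coset[OF u])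
    fix a assume "a \<in> carrier \<nn>" "a \<ominus>\<^bsub>\<nn>\<^esub> u \<in> center \<nn>"
    then show "ad_class \<nn> (B a x u' x') = ad_class \<nn> (B u x u' x')"
      using u by (intro cong u' refl) (simp_all add: Z.coset_eq_iff)
  qed
  finally show ?thesis
    by (simp add: gS_def)
qed

lemma gS_cases:
  assumes "p \<in> carrier G"
  obtains u x where "u \<in> carrier \<nn>" "x \<in> carrier \<gg>" "p = (ad_class \<nn> u, x)"
  using assms unfolding gS_simps by (metis Z.quot_cases mem_Times_iff prod.collapse)

lemma rho_S_ad_class:
  "u \<in> carrier \<nn> \<Longrightarrow> rho_S K \<nn> S (ad_class \<nn> u, x) = T u x"
  by (simp add: rho_S_def \<nn>.ad_image_ad_class)

lemma rho_S_closed: "p \<in> carrier G \<Longrightarrow> rho_S K \<nn> S p \<in> carrier (der K \<nn>)"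
  by (erule gS_cases) (simp add: rho_S_ad_class T_closed)

lemma rho_q_injective:
  assumes "p \<in> carrier G" "p' \<in> carrier G" "rho_S K \<nn> S p = rho_S K \<nn> S p'" "q_S p = q_S p'"
  shows "p = p'"
proof -
  obtain u x where p: "u \<in> carrier \<nn>" "x \<in> carrier \<gg>" "p = (ad_class \<nn> u, x)"
    using assms(1) by (rule gS_cases)
  obtain u' x' where p': "u' \<in> carrier \<nn>" "x' \<in> carrier \<gg>" "p' = (ad_class \<nn> u', x')"
    using assms(2) by (rule gS_cases)
  show ?thesis
    using assms(3,4) p p' by (simp add: rho_S_ad_class q_S_def T_eq_iff)
qed

lemma bracket_closed: "\<lbrakk>p \<in> carrier G; p' \<in> carrier G\<rbrakk> \<Longrightarrow> lie_bracket G p p' \<in> carrier G"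
  by (elim gS_cases)
    (simp add: gS_bracket gS_simps(1) Z.coset_closed B_closed \<gg>.bracket_closed)

lemma rho_S_linear: "linear_map K G (der K \<nn>) (rho_S K \<nn> S)"
proof (rule linear_mapI[OF rho_S_closed])
  fix p assume "p \<in> carrier G"
  then obtain u x where p: "u \<in> carrier \<nn>" "x \<in> carrier \<gg>" "p = (ad_class \<nn> u, x)"
    by (rule gS_cases)
  {
    fix p' assume "p' \<in> carrier G"
    then obtain u' x' where p': "u' \<in> carrier \<nn>" "x' \<in> carrier \<gg>" "p' = (ad_class \<nn> u', x')"
      by (rule gS_cases)
    show "rho_S K \<nn> S (p \<oplus>\<^bsub>G\<^esub> p') = rho_S K \<nn> S p \<oplus>\<^bsub>der K \<nn>\<^esub> rho_S K \<nn> S p'"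
      using p p' by (simp add: gS_simps Z.quot_add rho_S_ad_class \<nn>.ad_add
        linear_mapD(2)[OF S_linear] \<nn>.ad_closed S_der der.M.a_ac)
  }
  fix c assume "c \<in> carrier K"
  then show "rho_S K \<nn> S (c \<odot>\<^bsub>G\<^esub> p) = c \<odot>\<^bsub>der K \<nn>\<^esub> rho_S K \<nn> S p"
    using p by (simp add: gS_simps Z.quot_smult rho_S_ad_class linear_mapD(3)[OF S_linear]
      linear_mapD(3)[OF \<nn>.ad_linear] \<nn>.ad_closed S_der der.smult_r_distr)
qed simp_all

lemma rho_S_lie_hom: "lie_hom K G (der K \<nn>) (rho_S K \<nn> S)"
  unfolding lie_hom_def
  by (auto simp: rho_S_linear gS_bracket rho_S_ad_class B_closed T_bracket elim!: gS_cases)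

lemma q_S_lie_hom: "lie_hom K G \<gg> q_S"
  unfolding lie_hom_def linear_map_def
  by (auto simp: q_S_def gS_def direct_prod_def)

lemma gS_topological_vector_space: "topological_vector_space K G"
  unfolding gS_def
  by (intro topological_vector_space_bracket_update direct_prod_topological_vector_space
    n_ad.topological_vector_space_axioms \<gg>.topological_vector_space_axioms)

interpretation G: topological_vector_space K G
  by (rule gS_topological_vector_space)

lemma gS_lie_algebra: "lie_algebra K G"
  using G.module_axioms \<nn>.der_lie_algebra \<gg>.lie_algebra_axioms rho_S_lie_hom q_S_lie_hom
    rho_q_injective bracket_closed
  by (rule lie_algebra_jointly_injective)

interpretation GL: lie_algebra K G
  by (rule gS_lie_algebra)

section \<open>Continuity of the bracket and of the action\<close>

abbreviation proj :: "'n \<times> 'g \<Rightarrow> 'n set \<times> 'g"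
  where "proj \<equiv> map_prod (\<lambda>u. ad_class \<nn> u) (\<lambda>x. x)"

lemma proj_open_quotient_map:
  "open_quotient_map (prod_topology (lie_top \<nn>) (lie_top \<gg>)) (lie_top G) proj"
  unfolding gS_simps
  by (intro open_quotient_map_prod Z.coset_open_quotient_map open_quotient_map_ident)

lemma continuous_map_S:
  assumes "continuous_map X (lie_top \<gg>) f" "continuous_map X (lie_top \<nn>) h"
  shows "continuous_map X (lie_top \<nn>) (\<lambda>t. S (f t) (h t))"
proof -
  have "continuous_map (prod_topology (lie_top \<gg>) (lie_top \<nn>)) (lie_top \<nn>) (\<lambda>(x, u). S x u)"
    using action by (simp add: continuous_outer_action_def)
  from continuous_map_compose[OF continuous_map_pairedI[OF assms] this] show ?thesis
    by (simp add: o_def)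
qed

lemma continuous_map_\<omega>:
  assumes "continuous_map X (lie_top \<gg>) f" "continuous_map X (lie_top \<gg>) h"
  shows "continuous_map X (lie_top \<nn>) (\<lambda>t. \<omega> (f t) (h t))"
proof -
  have "continuous_map (prod_topology (lie_top \<gg>) (lie_top \<gg>)) (lie_top \<nn>) (\<lambda>(x, y). \<omega> x y)"
    using cochain by (simp add: C2_def)
  from continuous_map_compose[OF continuous_map_pairedI[OF assms] this] show ?thesis
    by (simp add: o_def)
qed

lemma continuous_map_fst_comp:
  "continuous_map X (prod_topology Y Z) f \<Longrightarrow> continuous_map X Y (\<lambda>t. fst (f t))"
  using continuous_map_fst_of[of X Y Z f] by (simp add: o_def)

lemma continuous_map_snd_comp:
  "continuous_map X (prod_topology Y Z) f \<Longrightarrow> continuous_map X Z (\<lambda>t. snd (f t))"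
  using continuous_map_snd_of[of X Y Z f] by (simp add: o_def)

lemma gS_continuous_bracket:
  "continuous_map (prod_topology (lie_top G) (lie_top G)) (lie_top G) (\<lambda>(p, p'). lie_bracket G p p')"
proof (rule continuous_map_open_quotient)
  let ?X = "prod_topology (lie_top \<nn>) (lie_top \<gg>)"
  show "open_quotient_map (prod_topology ?X ?X) (prod_topology (lie_top G) (lie_top G))
      (map_prod proj proj)"
    by (intro open_quotient_map_prod proj_open_quotient_map)
  let ?u = "\<lambda>t. fst (fst t)" and ?x = "\<lambda>t. snd (fst t)"
    and ?u' = "\<lambda>t. fst (snd t)" and ?x' = "\<lambda>t. snd (snd t)"
  have comp: "continuous_map (prod_topology ?X ?X) (lie_top \<nn>) ?u"
    "continuous_map (prod_topology ?X ?X) (lie_top \<gg>) ?x"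
    "continuous_map (prod_topology ?X ?X) (lie_top \<nn>) ?u'"
    "continuous_map (prod_topology ?X ?X) (lie_top \<gg>) ?x'"
    by (rule continuous_map_fst_comp continuous_map_snd_comp, rule continuous_map_fst continuous_map_snd)+
  \<comment> \<open>Here the joint continuity of S and the continuity of \<omega> enter.\<close>
  have "continuous_map (prod_topology ?X ?X) (lie_top \<nn>) (\<lambda>t. B (?u t) (?x t) (?u' t) (?x' t))"
    by (intro \<nn>.continuous_map_vadd \<nn>.continuous_map_vminus \<nn>.continuous_map_bracket
      continuous_map_S continuous_map_\<omega> comp)
  from continuous_map_compose[OF this Z.coset_continuous]
  have "continuous_map (prod_topology ?X ?X) (lie_top G)
      (\<lambda>t. (ad_class \<nn> (B (?u t) (?x t) (?u' t) (?x' t)), lie_bracket \<gg> (?x t) (?x' t)))"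
    unfolding gS_simps
    by (intro continuous_map_pairedI \<gg>.continuous_map_bracket comp) (simp add: o_def)
  then show "continuous_map (prod_topology ?X ?X) (lie_top G)
      (\<lambda>t. case map_prod proj proj t of (p, p') \<Rightarrow> lie_bracket G p p')"
    by (rule continuous_map_eq) (auto simp: \<nn>.topspace_lie_top \<gg>.topspace_lie_top gS_bracket)
qed

theorem gS_topological_lie_algebra: "topological_lie_algebra K G"
  by (intro topological_lie_algebra.intro topological_lie_algebra_axioms.intro
    gS_topological_vector_space gS_lie_algebra gS_continuous_bracket)

text \<open>The module identity is the homomorphism property of \<open>rho_S\<close> evaluated at a
  vector. Continuity is a joint condition on the pair (p, v), so no topology on
  \<open>der K \<nn>\<close> is involved.\<close>

theorem rho_S_continuous_module: "continuous_module K G \<nn> (rho_S K \<nn> S)"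
  unfolding continuous_module_def
proof (intro conjI ballI gS_topological_lie_algebra \<nn>.topological_vector_space_axioms)
  fix p assume p: "p \<in> carrier G"
  show "linear_map K \<nn> \<nn> (rho_S K \<nn> S p)"
    by (rule \<nn>.derD(2)[OF rho_S_closed[OF p]])
  fix p' v assume p': "p' \<in> carrier G" and v: "v \<in> carrier \<nn>"
  have "rho_S K \<nn> S (lie_bracket G p p') = lie_bracket (der K \<nn>) (rho_S K \<nn> S p) (rho_S K \<nn> S p')"
    using rho_S_lie_hom p p' by (simp add: lie_hom_def)
  then show "rho_S K \<nn> S (lie_bracket G p p') v =
      rho_S K \<nn> S p (rho_S K \<nn> S p' v) \<ominus>\<^bsub>\<nn>\<^esub> rho_S K \<nn> S p' (rho_S K \<nn> S p v)"
    using v by (simp add: \<nn>.der_apply)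
next
  fix v assume v: "v \<in> carrier \<nn>"
  show "linear_map K G \<nn> (\<lambda>p. rho_S K \<nn> S p v)"
    using v by (intro linear_mapI)
      (simp_all add: linear_mapD(2,3)[OF rho_S_linear] \<nn>.der_apply \<nn>.derD(3)[OF rho_S_closed])
next
  show "continuous_map (prod_topology (lie_top G) (lie_top \<nn>)) (lie_top \<nn>)
      (\<lambda>(p, v). rho_S K \<nn> S p v)"
  proof (rule continuous_map_open_quotient)
    let ?X = "prod_topology (prod_topology (lie_top \<nn>) (lie_top \<gg>)) (lie_top \<nn>)"
    show "open_quotient_map ?X (prod_topology (lie_top G) (lie_top \<nn>)) (map_prod proj (\<lambda>v. v))"
      by (intro open_quotient_map_prod proj_open_quotient_map open_quotient_map_ident)
    have "continuous_map ?X (lie_top \<nn>)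
        (\<lambda>t. lie_bracket \<nn> (fst (fst t)) (snd t) \<oplus>\<^bsub>\<nn>\<^esub> S (snd (fst t)) (snd t))"
      by (intro \<nn>.continuous_map_vadd \<nn>.continuous_map_bracket continuous_map_S continuous_map_snd
        continuous_map_fst_comp[OF continuous_map_fst] continuous_map_snd_comp[OF continuous_map_fst])
    then show "continuous_map ?X (lie_top \<nn>)
        (\<lambda>t. case map_prod proj (\<lambda>v. v) t of (p, v) \<Rightarrow> rho_S K \<nn> S p v)"
      by (rule continuous_map_eq)
        (auto simp: \<nn>.topspace_lie_top \<gg>.topspace_lie_top rho_S_ad_class T_apply)
  qed
qed


subsection \<open>The extension\<close>

lemma q_S_continuous: "continuous_map (lie_top G) (lie_top \<gg>) q_S"
proof -
  have "q_S = (snd :: 'n set \<times> 'g \<Rightarrow> 'g)"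
    by (auto simp: q_S_def)
  then show ?thesis
    by (simp add: gS_simps continuous_map_snd)
qed

lemma q_S_tvs_hom: "tvs_hom K G \<gg> q_S"
  using q_S_lie_hom q_S_continuous
  by (intro tvs_hom.intro tvs_hom_axioms.intro gS_topological_vector_space
    \<gg>.topological_vector_space_axioms) (simp add: continuous_linear_map_def lie_hom_def)

interpretation q: tvs_hom K G \<gg> q_S
  by (rule q_S_tvs_hom)

lemma kernel_q_S: "a_kernel G \<gg> q_S = n_ad_incl \<gg> ` carrier (n_ad \<nn>)"
  by (auto simp: a_kernel_def' gS_simps q_S_def n_ad_incl_def)

text \<open>Linear, but in general no Lie homomorphism: the bracket of (0, x) and (0, x') has first
  component ad (\<omega> x x'). The extension splits topologically, not necessarily as Lie
  algebras.\<close>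

abbreviation section_S :: "'g \<Rightarrow> 'n set \<times> 'g"
  where "section_S x \<equiv> (\<zero>\<^bsub>n_ad \<nn>\<^esub>, x)"

lemma section_S_continuous_linear: "continuous_linear_map K \<gg> G section_S"
  unfolding continuous_linear_map_def
proof
  show "linear_map K \<gg> G section_S"
    by (rule linear_mapI) (simp_all add: gS_simps)
  show "continuous_map (lie_top \<gg>) (lie_top G) section_S"
    unfolding gS_simps
    by (intro continuous_map_pairedI) (simp_all add: n_ad.topspace_lie_top)
qed

lemma kernel_q_S_split: "topologically_split K G (n_ad_incl \<gg> ` carrier (n_ad \<nn>))"
  unfolding kernel_q_S[symmetric]
  by (rule q.topologically_split_kernel[OF section_S_continuous_linear]) (simp add: q_S_def)

text \<open>A continuous map with a continuous right inverse is a quotient map, and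
  \<open>section_S\<close> is a right inverse.\<close>

lemma q_S_quotient_map: "quotient_map (lie_top G) (lie_top \<gg>) q_S"
proof (rule retraction_imp_quotient_map)
  have "retraction_maps (lie_top G) (lie_top \<gg>) q_S section_S"
    using section_S_continuous_linear q_S_continuous
    by (simp add: retraction_maps_def continuous_linear_map_def q_S_def)
  then show "retraction_map (lie_top G) (lie_top \<gg>) q_S"
    unfolding retraction_map_def by blast
qed

lemma n_ad_incl_bracket:
  assumes "X \<in> carrier (n_ad \<nn>)" "Y \<in> carrier (n_ad \<nn>)"
  shows "lie_bracket G (n_ad_incl \<gg> X) (n_ad_incl \<gg> Y) = n_ad_incl \<gg> (lie_bracket (n_ad \<nn>) X Y)"
proof -
  obtain u where u: "u \<in> carrier \<nn>" "X = ad_class \<nn> u" using assms(1) by (rule Z.quot_cases)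
  obtain v where v: "v \<in> carrier \<nn>" "Y = ad_class \<nn> v" using assms(2) by (rule Z.quot_cases)
  \<comment> \<open>With both \<gg>-components zero, linearity of S and \<omega> removes every term
    except the bracket of \<nn>.\<close>
  have "B u \<zero>\<^bsub>\<gg>\<^esub> v \<zero>\<^bsub>\<gg>\<^esub> = lie_bracket \<nn> u v"
    using u v by (simp add: S_zero \<nn>.der_apply \<omega>_zero_right \<nn>.bracket_closed \<nn>.M.abelian_group_simprules)
  then show ?thesis
    using u v by (simp add: n_ad_incl_def gS_bracket Z.quot_bracket \<gg>.bracket_zero_left)
qed

lemma n_ad_incl_linear: "linear_map K (n_ad \<nn>) G (n_ad_incl \<gg>)"
  by (rule linear_mapI) (simp_all add: gS_simps n_ad_incl_def)

lemma n_ad_incl_continuous: "continuous_map (lie_top (n_ad \<nn>)) (lie_top G) (n_ad_incl \<gg>)"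
  unfolding gS_simps n_ad_incl_def
  by (intro continuous_map_pairedI) (simp_all add: \<gg>.topspace_lie_top)

lemma n_ad_incl_iso:
  "top_lie_iso K (n_ad \<nn>) (sub G (n_ad_incl \<gg> ` carrier (n_ad \<nn>))) (n_ad_incl \<gg>)"
  unfolding top_lie_iso_def lie_hom_def
proof (intro conjI ballI)
  let ?I = "n_ad_incl \<gg> ` carrier (n_ad \<nn>)"
  show "linear_map K (n_ad \<nn>) (sub G ?I) (n_ad_incl \<gg>)"
    using n_ad_incl_linear by (auto simp: linear_map_def sub_def)
  show "n_ad_incl \<gg> (lie_bracket (n_ad \<nn>) X Y) =
      lie_bracket (sub G ?I) (n_ad_incl \<gg> X) (n_ad_incl \<gg> Y)"
    if "X \<in> carrier (n_ad \<nn>)" "Y \<in> carrier (n_ad \<nn>)" for X Y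
    using n_ad_incl_bracket[OF that] by (simp add: sub_def)
  have "homeomorphic_maps (lie_top (n_ad \<nn>)) (subtopology (lie_top G) ?I) (n_ad_incl \<gg>) fst"
    unfolding homeomorphic_maps_def
  proof (intro conjI)
    show "continuous_map (lie_top (n_ad \<nn>)) (subtopology (lie_top G) ?I) (n_ad_incl \<gg>)"
      using n_ad_incl_continuous by (auto simp: continuous_map_in_subtopology n_ad.topspace_lie_top)
    show "continuous_map (subtopology (lie_top G) ?I) (lie_top (n_ad \<nn>)) fst"
      unfolding gS_simps by (intro continuous_map_from_subtopology continuous_map_fst)
  qed (auto simp: n_ad_incl_def)
  then show "homeomorphic_map (lie_top (n_ad \<nn>)) (lie_top (sub G ?I)) (n_ad_incl \<gg>)"
    by (simp add: sub_def homeomorphic_maps_imp_map)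
qed

lemma kernel_q_S_ideal: "lie_ideal K G (n_ad_incl \<gg> ` carrier (n_ad \<nn>))"
  unfolding kernel_q_S[symmetric] lie_ideal_def
proof (intro conjI ballI q.submodule_kernel)
  fix p p' assume p: "p \<in> carrier G" and p': "p' \<in> a_kernel G \<gg> q_S"
  have "q_S (lie_bracket G p p') = lie_bracket \<gg> (q_S p) \<zero>\<^bsub>\<gg>\<^esub>"
    using q_S_lie_hom p p' by (simp add: lie_hom_def q.mem_kernel)
  then show "lie_bracket G p p' \<in> a_kernel G \<gg> q_S"
    using p p' q.q_closed[OF p] by (simp add: q.mem_kernel bracket_closed \<gg>.bracket_zero_right)
qed

theorem gS_split_extension: "split_extension K (n_ad \<nn>) G \<gg> (n_ad_incl \<gg>) q_S"
  unfolding split_extension_def quotient_morphism_def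
  using n_ad_topological_lie_algebra gS_topological_lie_algebra \<gg>.topological_lie_algebra_axioms
    n_ad_incl_iso kernel_q_S_ideal kernel_q_S_split q_S_lie_hom q_S_quotient_map kernel_q_S
  by (intro conjI)


subsection \<open>The crossed module\<close>

lemma alpha_S_eq: "alpha_S \<gg> \<nn> = (\<lambda>u. n_ad_incl \<gg> (ad_class \<nn> u))"
  by (simp add: fun_eq_iff alpha_S_def n_ad_incl_def)

lemma alpha_S_image: "alpha_S \<gg> \<nn> ` carrier \<nn> = n_ad_incl \<gg> ` carrier (n_ad \<nn>)"
  by (simp add: alpha_S_eq Z.carrier_quot image_image)

lemma kernel_alpha_S: "a_kernel \<nn> G (alpha_S \<gg> \<nn>) = center \<nn>"
proof -
  have "alpha_S \<gg> \<nn> u = \<zero>\<^bsub>G\<^esub> \<longleftrightarrow> u \<in> center \<nn>" if "u \<in> carrier \<nn>" for u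
    using that by (simp add: alpha_S_def gS_simps quot_simps Z.coset_eq_self_iff)
  then show ?thesis
    unfolding a_kernel_def' using Z.subspace_mem(2) by blast
qed

lemma alpha_S_top_lie_hom: "top_lie_hom K \<nn> G (alpha_S \<gg> \<nn>)"
  unfolding top_lie_hom_def lie_hom_def alpha_S_eq
proof (intro conjI ballI)
  show "linear_map K \<nn> G (\<lambda>u. n_ad_incl \<gg> (ad_class \<nn> u))"
    by (rule linear_map_compose[OF Z.coset_linear n_ad_incl_linear])
  show "continuous_map (lie_top \<nn>) (lie_top G) (\<lambda>u. n_ad_incl \<gg> (ad_class \<nn> u))"
    using continuous_map_compose[OF Z.coset_continuous n_ad_incl_continuous] by (simp add: o_def)
qed (simp add: n_ad_incl_bracket Z.coset_closed Z.quot_bracket)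

theorem alpha_S_crossed_module: "crossed_module K \<nn> G (alpha_S \<gg> \<nn>) (rho_S K \<nn> S)"
  unfolding crossed_module_def
proof (intro conjI ballI \<nn>.topological_lie_algebra_axioms gS_topological_lie_algebra
    alpha_S_top_lie_hom rho_S_continuous_module)
  fix p h assume "p \<in> carrier G" and h: "h \<in> carrier \<nn>"
  then obtain u x where p: "u \<in> carrier \<nn>" "x \<in> carrier \<gg>" "p = (ad_class \<nn> u, x)"
    by (elim gS_cases)
  \<comment> \<open>Because \<open>alpha_S\<close> has zero \<gg>-component, the terms of
    \<open>B\<close> with S 0 and \<omega> x 0 vanish, and what remains is [u, h] + S x h, the
    action on h.\<close>
  have "B u x h \<zero>\<^bsub>\<gg>\<^esub> = T u x h"
    using p h by (simp add: S_zero \<nn>.der_apply \<nn>.ad_apply \<omega>_zero_right S_closed \<nn>.bracket_closed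
      \<nn>.M.abelian_group_simprules)
  then show "alpha_S \<gg> \<nn> (rho_S K \<nn> S p h) = lie_bracket G p (alpha_S \<gg> \<nn> h)"
    using p h by (simp add: alpha_S_def gS_bracket rho_S_ad_class \<gg>.bracket_zero_right)
next
  fix h h' assume "h \<in> carrier \<nn>" "h' \<in> carrier \<nn>"
  then show "rho_S K \<nn> S (alpha_S \<gg> \<nn> h) h' = lie_bracket \<nn> h h'"
    by (simp add: alpha_S_def rho_S_ad_class S_zero \<nn>.der_apply \<nn>.ad_apply \<nn>.bracket_closed)
qed

theorem alpha_S_split_iff:
  "topologically_split_morphism K \<nn> G (alpha_S \<gg> \<nn>) \<longleftrightarrow> topologically_split K \<nn> (center \<nn>)"
  by (simp add: topologically_split_morphism_def kernel_alpha_S alpha_S_image kernel_q_S_split)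

text \<open>The image of \<open>alpha_S\<close> is the kernel of \<open>q_S\<close>, so this is the
  first isomorphism theorem for \<open>q_S\<close>; the inverse is continuous because
  \<open>q_S\<close> is a quotient map.\<close>

theorem coker_alpha_S_iso:
  "top_lie_iso K (coker \<nn> G (alpha_S \<gg> \<nn>)) \<gg> (\<lambda>X. the_elem (q_S ` X))"
  unfolding top_lie_iso_def lie_hom_def coker_def alpha_S_image kernel_q_S[symmetric]
proof (intro conjI ballI q.induced_linear q.induced_homeomorphic q_S_quotient_map)
  interpret GQ: tla_quotient K G "a_kernel G \<gg> q_S"
  proof (intro tla_quotient.intro tla_quotient_axioms.intro tla.intro q.kernel_quotient
      gS_topological_lie_algebra)
    fix p p' assume "p \<in> carrier G" "p' \<in> a_kernel G \<gg> q_S"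
    then show "lie_bracket G p p' \<in> a_kernel G \<gg> q_S"
      using kernel_q_S_ideal unfolding kernel_q_S[symmetric] lie_ideal_def by blast
  qed
  fix X Y assume "X \<in> carrier (quot G (a_kernel G \<gg> q_S))" "Y \<in> carrier (quot G (a_kernel G \<gg> q_S))"
  then obtain p p' where "p \<in> carrier G" "X = a_kernel G \<gg> q_S +>\<^bsub>G\<^esub> p"
    and "p' \<in> carrier G" "Y = a_kernel G \<gg> q_S +>\<^bsub>G\<^esub> p'"
    by (elim GQ.quot_cases)
  then show "the_elem (q_S ` lie_bracket (quot G (a_kernel G \<gg> q_S)) X Y) =
      lie_bracket \<gg> (the_elem (q_S ` X)) (the_elem (q_S ` Y))"
    using q_S_lie_hom
    by (simp add: GQ.quot_bracket q.induced_coset bracket_closed lie_hom_def)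
qed

end

section \<open>Independence of the choices\<close>

text \<open>Since ad \<omega> and ad \<omega>' are the same curvature, \<omega> and \<omega>' differ
  by central values, which vanish in \<open>n_ad\<close>. Formally, \<open>rho_S\<close> and
  \<open>q_S\<close> do not mention \<omega>, both brackets have the same images under them, and the
  two maps are jointly injective.\<close>

lemma gS_bracket_cong:
  assumes "outer_action K \<gg> \<nn> S \<omega>" "outer_action K \<gg> \<nn> S \<omega>'"
    and p: "p \<in> carrier (gS \<gg> \<nn> S \<omega>)" "p' \<in> carrier (gS \<gg> \<nn> S \<omega>)"
  shows "lie_bracket (gS \<gg> \<nn> S \<omega>') p p' = lie_bracket (gS \<gg> \<nn> S \<omega>) p p'"
proof -
  interpret A: outer_action K \<gg> \<nn> S \<omega> by fact
  interpret A': outer_action K \<gg> \<nn> S \<omega>' by fact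
  have carrier: "carrier A'.G = carrier A.G"
    by (simp only: A.gS_simps A'.gS_simps)
  note p' = p[folded carrier]
  show ?thesis
  proof (rule A.rho_q_injective)
    show "lie_bracket A'.G p p' \<in> carrier A.G"
      using A'.bracket_closed[OF p'] by (simp only: carrier)
    show "lie_bracket A.G p p' \<in> carrier A.G"
      by (rule A.bracket_closed[OF p])
    show "rho_S K \<nn> S (lie_bracket A'.G p p') = rho_S K \<nn> S (lie_bracket A.G p p')"
      using A.rho_S_lie_hom A'.rho_S_lie_hom p p' by (simp add: lie_hom_def)
    show "q_S (lie_bracket A'.G p p') = q_S (lie_bracket A.G p p')"
      using A.q_S_lie_hom A'.q_S_lie_hom p p' by (simp add: lie_hom_def)
  qed
qed

text \<open>If \<open>S = S' + ad \<circ> \<gamma>\<close>, then \<open>ad u + S x = ad (u + \<gamma> x) + S' x\<close>; hence the equivalence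
  is \<open>(ad u, x) \<mapsto> (ad (u + \<gamma> x), x)\<close>.\<close>

lemma gS_equivalent_extensions:
  fixes K :: "('k, 'c) topological_ring_scheme"
    and \<gg> :: "('k, 'g) top_lie" and \<nn> :: "('k, 'n) top_lie"
  assumes "outer_action K \<gg> \<nn> S \<omega>" "outer_action K \<gg> \<nn> S' \<omega>'"
    and "outer_equiv K \<gg> \<nn> S S'"
  shows "equivalent_extensions K (n_ad \<nn>)
    (gS \<gg> \<nn> S \<omega>) (n_ad_incl \<gg>) q_S (gS \<gg> \<nn> S' \<omega>') (n_ad_incl \<gg>) q_S"
proof -
  interpret A: outer_action K \<gg> \<nn> S \<omega> by fact
  interpret A': outer_action K \<gg> \<nn> S' \<omega>' by fact
  interpret Z: tla_quotient K \<nn> "center \<nn>"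
    by (rule A.\<nn>.center_quotient)
  interpret N: topological_lie_algebra K "n_ad \<nn>"
    by (rule A.n_ad_topological_lie_algebra)
  interpret der: lie_algebra K "der K \<nn>"
    by (rule A.\<nn>.der_lie_algebra)
  obtain \<gamma> where \<gamma>: "continuous_linear_map K \<gg> \<nn> \<gamma>"
    and S: "\<And>x. x \<in> carrier \<gg> \<Longrightarrow> S x = S' x \<oplus>\<^bsub>der K \<nn>\<^esub> ad \<nn> (\<gamma> x)"
    using assms(3) unfolding outer_equiv_def by blast
  \<comment> \<open>Only the class of \<gamma> x enters, so the correction is taken directly in
    \<open>n_ad\<close>; subtracting it gives the inverse map \<open>\<psi>\<close>.\<close>
  define \<delta> where "\<delta> = (\<lambda>x. ad_class \<nn> (\<gamma> x))"
  have \<gamma>_lin: "linear_map K \<gg> \<nn> \<gamma>"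
    using \<gamma> by (simp add: continuous_linear_map_def)
  have \<delta>_lin: "linear_map K \<gg> (n_ad \<nn>) \<delta>"
    unfolding \<delta>_def by (rule linear_map_compose[OF \<gamma>_lin Z.coset_linear])
  have \<delta>_cont: "continuous_map (lie_top \<gg>) (lie_top (n_ad \<nn>)) \<delta>"
  proof -
    have "continuous_map (lie_top \<gg>) (lie_top \<nn>) \<gamma>"
      using \<gamma> by (simp add: continuous_linear_map_def)
    from continuous_map_compose[OF this Z.coset_continuous] show ?thesis
      by (simp add: \<delta>_def o_def)
  qed
  note \<delta> = linear_mapD[OF \<delta>_lin]
  define \<phi> where "\<phi> = (\<lambda>p. (fst p \<oplus>\<^bsub>n_ad \<nn>\<^esub> \<delta> (snd p), snd p))"
  define \<psi> where "\<psi> = (\<lambda>p. (fst p \<ominus>\<^bsub>n_ad \<nn>\<^esub> \<delta> (snd p), snd p))"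
  have \<phi>_closed: "\<phi> p \<in> carrier A'.G" if "p \<in> carrier A.G" for p
    using that by (auto simp: A.gS_simps A'.gS_simps \<phi>_def \<delta>)
  have q_\<phi>: "q_S (\<phi> p) = q_S p" for p
    by (cases p) (simp add: q_S_def \<phi>_def)
  have rho_\<phi>: "rho_S K \<nn> S' (\<phi> p) = rho_S K \<nn> S p" if "p \<in> carrier A.G" for p
    using that
  proof (rule A.gS_cases)
    fix u x assume u: "u \<in> carrier \<nn>" and x: "x \<in> carrier \<gg>" and p: "p = (ad_class \<nn> u, x)"
    have \<gamma>x: "\<gamma> x \<in> carrier \<nn>"
      using x by (rule linear_mapD(1)[OF \<gamma>_lin])
    have "\<phi> p = (ad_class \<nn> (u \<oplus>\<^bsub>\<nn>\<^esub> \<gamma> x), x)"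
      using u \<gamma>x p by (simp add: \<phi>_def \<delta>_def Z.quot_add)
    then show ?thesis
      using u x \<gamma>x p
      by (simp add: A.rho_S_ad_class A'.rho_S_ad_class S A.\<nn>.ad_add A.\<nn>.ad_closed A'.S_der
        der.M.a_ac)
  qed
  have \<phi>_hom: "lie_hom K A.G A'.G \<phi>"
    unfolding lie_hom_def
  proof (intro conjI ballI)
    show "linear_map K A.G A'.G \<phi>"
      by (rule linear_mapI[OF \<phi>_closed])
        (auto simp: A.gS_simps A'.gS_simps \<phi>_def \<delta> N.M.a_ac N.smult_r_distr)
    fix p p' assume p: "p \<in> carrier A.G" "p' \<in> carrier A.G"
    \<comment> \<open>Both sides have the same images under \<open>rho_S K \<nn> S'\<close> and
      \<open>q_S\<close>, since \<phi> intertwines these maps with those of S. The relation linking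
      \<omega>, \<omega>' and \<gamma> is thus never written down.\<close>
    show "\<phi> (lie_bracket A.G p p') = lie_bracket A'.G (\<phi> p) (\<phi> p')"
      using p A.rho_S_lie_hom A'.rho_S_lie_hom A.q_S_lie_hom A'.q_S_lie_hom
      by (intro A'.rho_q_injective \<phi>_closed A.bracket_closed A'.bracket_closed)
        (simp_all add: rho_\<phi> q_\<phi> lie_hom_def A.bracket_closed \<phi>_closed)
  qed
  have "homeomorphic_maps (lie_top A.G) (lie_top A'.G) \<phi> \<psi>"
    unfolding homeomorphic_maps_def A.gS_simps A'.gS_simps
  proof (intro conjI ballI)
    let ?X = "prod_topology (lie_top (n_ad \<nn>)) (lie_top \<gg>)"
    have \<delta>_snd: "continuous_map ?X (lie_top (n_ad \<nn>)) (\<lambda>p. \<delta> (snd p))"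
      using continuous_map_compose[OF continuous_map_snd \<delta>_cont] by (simp add: o_def)
    show "continuous_map ?X ?X \<phi>"
      unfolding \<phi>_def
      by (intro continuous_map_pairedI N.continuous_map_vadd continuous_map_fst continuous_map_snd \<delta>_snd)
    show "continuous_map ?X ?X \<psi>"
      unfolding \<psi>_def
      by (intro continuous_map_pairedI N.continuous_map_vminus continuous_map_fst continuous_map_snd \<delta>_snd)
    fix p assume "p \<in> topspace ?X"
    then obtain X x where p: "p = (X, x)" "X \<in> carrier (n_ad \<nn>)" "x \<in> carrier \<gg>"
      by (auto simp: N.topspace_lie_top A.\<gg>.topspace_lie_top)
    have "X \<oplus>\<^bsub>n_ad \<nn>\<^esub> \<delta> x \<ominus>\<^bsub>n_ad \<nn>\<^esub> \<delta> x = X" "X \<ominus>\<^bsub>n_ad \<nn>\<^esub> \<delta> x \<oplus>\<^bsub>n_ad \<nn>\<^esub> \<delta> x = X"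
      using p(2) \<delta>(1)[OF p(3)] by algebra+
    then show "\<psi> (\<phi> p) = p" "\<phi> (\<psi> p) = p"
      by (simp_all add: p(1) \<phi>_def \<psi>_def)
  qed
  then have "top_lie_iso K A.G A'.G \<phi>"
    using \<phi>_hom by (simp add: top_lie_iso_def homeomorphic_maps_imp_map)
  moreover have "\<phi> (n_ad_incl \<gg> X) = n_ad_incl \<gg> X" if "X \<in> carrier (n_ad \<nn>)" for X
    using that linear_map_zero[OF A.\<gg>.M.abelian_group_axioms N.M.abelian_group_axioms \<delta>_lin]
    by (simp add: n_ad_incl_def \<phi>_def)
  ultimately show ?thesis
    unfolding equivalent_extensions_def using q_\<phi> by blast
qed

theorem mainTheorem8:
  fixes K :: "'k topological_ring"
    and \<gg> :: "('k, 'g) top_lie"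
    and \<nn> :: "('k, 'n) top_lie"
    and S :: "'g \<Rightarrow> 'n \<Rightarrow> 'n"
    and \<omega> :: "'g \<Rightarrow> 'g \<Rightarrow> 'n"
  assumes "topological_field K" and "char_0 K"
    and "topological_lie_algebra K \<gg>"
    and "topological_lie_algebra K \<nn>"
    and "continuous_outer_action K \<gg> \<nn> S"
    and "\<omega> \<in> C2 K \<gg> \<nn>"
    and "curvature_is_ad K \<gg> \<nn> S \<omega>"
  shows
    "(\<forall>u\<in>carrier \<nn>. \<forall>x\<in>carrier \<gg>. \<forall>u'\<in>carrier \<nn>. \<forall>x'\<in>carrier \<gg>.
        lie_bracket (gS \<gg> \<nn> S \<omega>) (ad_class \<nn> u, x) (ad_class \<nn> u', x') =
          (ad_class \<nn> (lie_bracket \<nn> u u' \<oplus>\<^bsub>\<nn>\<^esub> S x u' \<ominus>\<^bsub>\<nn>\<^esub> S x' u \<oplus>\<^bsub>\<nn>\<^esub> \<omega> x x'),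
           lie_bracket \<gg> x x')) \<and>
     (\<forall>\<omega>'\<in>C2 K \<gg> \<nn>. curvature_is_ad K \<gg> \<nn> S \<omega>' \<longrightarrow>
        (\<forall>p\<in>carrier (gS \<gg> \<nn> S \<omega>). \<forall>p'\<in>carrier (gS \<gg> \<nn> S \<omega>).
           lie_bracket (gS \<gg> \<nn> S \<omega>') p p' = lie_bracket (gS \<gg> \<nn> S \<omega>) p p')) \<and>
     (topological_lie_algebra K (gS \<gg> \<nn> S \<omega>)) \<and>
     (split_extension K (n_ad \<nn>) (gS \<gg> \<nn> S \<omega>) \<gg> (n_ad_incl \<gg>) q_S) \<and>
     (\<forall>S' \<omega>'. continuous_outer_action K \<gg> \<nn> S' \<and> outer_equiv K \<gg> \<nn> S S' \<and>
        \<omega>' \<in> C2 K \<gg> \<nn> \<and> curvature_is_ad K \<gg> \<nn> S' \<omega>' \<longrightarrow>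
        equivalent_extensions K (n_ad \<nn>)
          (gS \<gg> \<nn> S \<omega>) (n_ad_incl \<gg>) q_S
          (gS \<gg> \<nn> S' \<omega>') (n_ad_incl \<gg>) q_S) \<and>
     (rho_S K \<nn> S \<in> carrier (gS \<gg> \<nn> S \<omega>) \<rightarrow> carrier (der K \<nn>)) \<and>
     (\<forall>u\<in>carrier \<nn>. \<forall>x\<in>carrier \<gg>.
        rho_S K \<nn> S (ad_class \<nn> u, x) = ad \<nn> u \<oplus>\<^bsub>der K \<nn>\<^esub> S x) \<and>
     (continuous_module K (gS \<gg> \<nn> S \<omega>) \<nn> (rho_S K \<nn> S)) \<and>
     (crossed_module K \<nn> (gS \<gg> \<nn> S \<omega>) (alpha_S \<gg> \<nn>) (rho_S K \<nn> S)) \<and>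
     (topologically_split_morphism K \<nn> (gS \<gg> \<nn> S \<omega>) (alpha_S \<gg> \<nn>) \<longleftrightarrow>
        topologically_split K \<nn> (center \<nn>)) \<and>
     (a_kernel \<nn> (gS \<gg> \<nn> S \<omega>) (alpha_S \<gg> \<nn>) = center \<nn>) \<and>
     (coker \<nn> (gS \<gg> \<nn> S \<omega>) (alpha_S \<gg> \<nn>) =
        quot (gS \<gg> \<nn> S \<omega>) (n_ad_incl \<gg> ` carrier (n_ad \<nn>))) \<and>
     (top_lie_iso K (coker \<nn> (gS \<gg> \<nn> S \<omega>) (alpha_S \<gg> \<nn>)) \<gg> (\<lambda>X. the_elem (q_S ` X)))"
proof -
  \<comment> \<open>Kept general in \<open>S'\<close> and \<open>\<omega>'\<close>, since the locale
    is needed for the given pair, for the same S with another cochain, and for an equivalent outer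
    action.\<close>
  have outer: "outer_action K \<gg> \<nn> S' \<omega>'"
    if "continuous_outer_action K \<gg> \<nn> S'" "\<omega>' \<in> C2 K \<gg> \<nn>" "curvature_is_ad K \<gg> \<nn> S' \<omega>'"
    for S' \<omega>'
    using that assms(3,4) by (intro outer_action.intro outer_action_axioms.intro tla.intro)
  interpret outer_action K \<gg> \<nn> S \<omega>
    using assms by (intro outer)
  show ?thesis
  proof (intro conjI)
    show "\<forall>\<omega>'\<in>C2 K \<gg> \<nn>. curvature_is_ad K \<gg> \<nn> S \<omega>' \<longrightarrow>
        (\<forall>p\<in>carrier G. \<forall>p'\<in>carrier G. lie_bracket (gS \<gg> \<nn> S \<omega>') p p' = lie_bracket G p p')"
      using gS_bracket_cong[OF outer_action_axioms outer] assms(5) by blast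
    show "\<forall>S' \<omega>'. continuous_outer_action K \<gg> \<nn> S' \<and> outer_equiv K \<gg> \<nn> S S' \<and>
        \<omega>' \<in> C2 K \<gg> \<nn> \<and> curvature_is_ad K \<gg> \<nn> S' \<omega>' \<longrightarrow>
        equivalent_extensions K (n_ad \<nn>) G (n_ad_incl \<gg>) q_S
          (gS \<gg> \<nn> S' \<omega>') (n_ad_incl \<gg>) q_S"
      using gS_equivalent_extensions[OF outer_action_axioms outer] by blast
    show "coker \<nn> G (alpha_S \<gg> \<nn>) = quot G (n_ad_incl \<gg> ` carrier (n_ad \<nn>))"
      by (simp add: coker_def alpha_S_image)
  qed (use gS_bracket rho_S_closed rho_S_ad_class gS_topological_lie_algebra gS_split_extension
      rho_S_continuous_module alpha_S_crossed_module alpha_S_split_iff kernel_alpha_S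
      coker_alpha_S_iso in blast)+
qed

end
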